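(* Let $k\geq 1$ and let $W=\{n_k\}$. Let $\Gamma\curvearrowright_{\alpha}X$ be a LEF action of the group $\Gamma$ on the set $X$, and let $H$ be a finite group. Then the verbal wreath product $H\wr^W_{\alpha}\Gamma$ is a LEF group.
   Context: Verbal wreath products. $F_\infty$ is the free group on $x_1,x_2,\ldots$; the words $n_k\in F_\infty$ are defined by $n_1=[x_2,x_1]$, $n_k=[x_{k+1},n_{k-1}]$. For a set of words $W\subseteq F_\infty$, a set $X$ and a group $H$, $F(H,X)=\ast_{x\in X}H_x$ is the free product of copies $H_x\cong H$; $W(F(H,X))$ is the verbal subgroup corresponding to $W$ (generated by all values of words of $W$ in $F(H,X)$); $[H]^{F(H,X)}$ is the normal subgroup of $F(H,X)$ generated by all $h_x^{-1}k_y^{-1}h_xk_y$ with $x\neq y$ in $X$, $h_x\in H_x$, $k_y\in H_y$. Set $F^W(H,X)=F(H,X)/(W(F(H,X))\cap[H]^{F(H,X)})$. An action $\Gamma\curvearrowright_\alpha X$ induces an action $\hat\alpha$ on $F^W(H,X)$ by automorphisms permuting the copies of $H$ ($g$ sends $H_x$ identically to $H_{\alpha(g)x}$), and $H\wr^W_\alpha\Gamma=F^W(H,X)\rtimes_{\hat\alpha}\Gamma$. A group $\Gamma$ is LEF (locally embeddable into finite groups) if for every finite $A\subseteq\Gamma$ there are a finite group $Q$ and an injective function $\phi:A\to Q$ with $\phi(gh)=\phi(g)\phi(h)$ whenever $g,h,gh\in A$. An action $\Gamma\curvearrowright_\alpha X$ on a set is a LEF action if for all finite $F\subseteq\Gamma$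 and $Z\subseteq X$ there exist a finite group $Q$, a finite set $Y$, an action $Q\curvearrowright_\beta Y$ and functions $\rho:\Gamma\to Q$, $\pi:Z\to Y$, with $\pi$ injective, such that (i) for all $g,h\in F$ with $gh\in F$, $\rho(gh)=\rho(g)\rho(h)$; (ii) if $g\in F$ and $x\in Z$ are such that $\alpha(g)\cdot x\in Z$, then $\pi(\alpha(g)\cdot x)=\beta(\rho(g))\cdot\pi(x)$.
   Formalization: The formal theorem also assumes that Γ is a LEF group; with ρ not required injective, any non-LEF Γ acting trivially, with H trivial, is a counterexample, and since Γ embeds in the wreath product the assumption is necessary. *)

theory Defs
  imports "HOL-Algebra.Generated_Groups" "HOL-Algebra.Group_Action" "HOL-Algebra.Elementary_Groups"
begin

section \<open>Free products of copies of a group\<close>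

text \<open>
  The free product of copies of \<open>H\<close> indexed by \<open>X\<close> is realised on normal forms: a letter
  \<open>(x, h)\<close> stands for the copy of \<open>h\<close> in the factor indexed by \<open>x\<close>, and a normal form is a list of
  nontrivial letters in which neighbouring letters belong to different factors.
\<close>

definition reduced_words :: "('h, 'b) monoid_scheme \<Rightarrow> 'x set \<Rightarrow> ('x \<times> 'h) list set" where
  "reduced_words H X =
    {w. set w \<subseteq> X \<times> (carrier H - {\<one>\<^bsub>H\<^esub>}) \<and> successively (\<lambda>p q. fst p \<noteq> fst q) w}"

fun fp_cons :: "('h, 'b) monoid_scheme \<Rightarrow> 'x \<times> 'h \<Rightarrow> ('x \<times> 'h) list \<Rightarrow> ('x \<times> 'h) list" where
  "fp_cons H (x, h) [] = (if h = \<one>\<^bsub>H\<^esub> then [] else [(x, h)])"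
| "fp_cons H (x, h) ((y, k) # w) =
    (if x = y then (if h \<otimes>\<^bsub>H\<^esub> k = \<one>\<^bsub>H\<^esub> then w else (x, h \<otimes>\<^bsub>H\<^esub> k) # w)
     else if h = \<one>\<^bsub>H\<^esub> then (y, k) # w else (x, h) # (y, k) # w)"

definition free_product :: "('h, 'b) monoid_scheme \<Rightarrow> 'x set \<Rightarrow> ('x \<times> 'h) list monoid" where
  "free_product H X =
    \<lparr>carrier = reduced_words H X, monoid.mult = foldr (fp_cons H), one = []\<rparr>"

definition fp_incl :: "('h, 'b) monoid_scheme \<Rightarrow> 'x \<Rightarrow> 'h \<Rightarrow> ('x \<times> 'h) list" where
  "fp_incl H x h = (if h = \<one>\<^bsub>H\<^esub> then [] else [(x, h)])"

lemma fp_cons_reduced: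
  assumes "group H" "x \<in> X" "h \<in> carrier H" "w \<in> reduced_words H X"
  shows "fp_cons H (x, h) w \<in> reduced_words H X"
proof -
  interpret group H by fact
  show ?thesis
    using assms
    by (cases w rule: list.exhaust; cases "tl w")
       (auto simp: reduced_words_def successively_Cons split: if_splits)
qed

lemma fp_cons_one: "group H \<Longrightarrow> w \<in> reduced_words H X \<Longrightarrow> fp_cons H (x, \<one>\<^bsub>H\<^esub>) w = w"
  by (cases w) (auto simp: reduced_words_def group.is_monoid monoid.l_one split: if_splits)

lemma fp_cons_fp_cons:
  assumes "group H" "h \<in> carrier H" "k \<in> carrier H" "w \<in> reduced_words H X"
  shows "fp_cons H (x, h) (fp_cons H (x, k) w) = fp_cons H (x, h \<otimes>\<^bsub>H\<^esub> k) w"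
proof (cases w)
  case Nil
  interpret group H by fact
  show ?thesis using assms Nil by auto
next
  case (Cons p v)
  interpret group H by fact
  obtain y l where p: "p = (y, l)" by (cases p)
  have l: "l \<in> carrier H" "l \<noteq> \<one>\<^bsub>H\<^esub>" using assms Cons p by (auto simp: reduced_words_def)
  show ?thesis
  proof (cases "x = y")
    case False
    then show ?thesis using assms Cons p by auto
  next
    case True
    show ?thesis
    proof (cases "k \<otimes>\<^bsub>H\<^esub> l = \<one>\<^bsub>H\<^esub>")
      case True2: True
      have "h \<otimes>\<^bsub>H\<^esub> k \<otimes>\<^bsub>H\<^esub> l = h" using True2 assms l by (simp add: m_assoc)
      moreover have "fp_cons H (y, h) v = (if h = \<one>\<^bsub>H\<^esub> then v else (y, h) # v)"
        using assms Cons p by (cases v) (auto simp: reduced_words_def successively_Cons)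
      ultimately show ?thesis using True True2 Cons p by simp
    next
      case False
      then show ?thesis using True Cons p assms l by (simp add: m_assoc)
    qed
  qed
qed

lemma foldr_fp_cons_reduced:
  assumes "group H" "set u \<subseteq> X \<times> carrier H" "w \<in> reduced_words H X"
  shows "foldr (fp_cons H) u w \<in> reduced_words H X"
  using assms(2) by (induction u) (auto intro!: fp_cons_reduced assms)

lemma reduced_words_letters: "w \<in> reduced_words H X \<Longrightarrow> set w \<subseteq> X \<times> carrier H"
  by (auto simp: reduced_words_def)

lemma foldr_fp_cons_assoc:
  assumes "group H" "u \<in> reduced_words H X" "v \<in> reduced_words H X" "w \<in> reduced_words H X"
  shows "foldr (fp_cons H) (foldr (fp_cons H) u v) w =
         foldr (fp_cons H) u (foldr (fp_cons H) v w)"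
proof -
  interpret group H by fact
  have step: "foldr (fp_cons H) (fp_cons H (x, h) v') w = fp_cons H (x, h) (foldr (fp_cons H) v' w)"
    if "x \<in> X" "h \<in> carrier H" "v' \<in> reduced_words H X" for x h v'
  proof (cases v')
    case Nil
    then show ?thesis using that assms by (simp add: fp_cons_one)
  next
    case (Cons p v'')
    obtain y l where p: "p = (y, l)" by (cases p)
    have l: "y \<in> X" "l \<in> carrier H" "set v'' \<subseteq> X \<times> carrier H"
      using that Cons p by (auto simp: reduced_words_def)
    have r: "foldr (fp_cons H) v'' w \<in> reduced_words H X"
      by (rule foldr_fp_cons_reduced) (use assms l in auto)
    have r2: "fp_cons H (y, l) (foldr (fp_cons H) v'' w) \<in> reduced_words H X"
      by (rule fp_cons_reduced) (use assms l r in auto)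
    show ?thesis
      using fp_cons_fp_cons[OF assms(1) that(2) l(2) r, of x] fp_cons_one[OF assms(1) r, of x]
        fp_cons_one[OF assms(1) r2, of x] Cons p
      by auto
  qed
  show ?thesis using reduced_words_letters[OF assms(2)]
  proof (induction u)
    case Nil
    then show ?case by simp
  next
    case (Cons p u)
    obtain x h where p: "p = (x, h)" by (cases p)
    have "foldr (fp_cons H) u v \<in> reduced_words H X"
      by (rule foldr_fp_cons_reduced) (use assms Cons in auto)
    then show ?case using Cons p step by auto
  qed
qed

lemma fp_left_inv:
  assumes "group H" "w \<in> reduced_words H X"
  shows "\<exists>v \<in> reduced_words H X. foldr (fp_cons H) v w = []"
  using assms(2)
proof (induction w)
  case Nil
  then show ?case by (auto intro: bexI[of _ "[]"])
next
  case (Cons p w)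
  interpret group H by fact
  obtain x h where p: "p = (x, h)" by (cases p)
  have w: "w \<in> reduced_words H X" and x: "x \<in> X" "h \<in> carrier H" "h \<noteq> \<one>\<^bsub>H\<^esub>"
    using Cons.prems p by (auto simp: reduced_words_def successively_Cons)
  obtain v where v: "v \<in> reduced_words H X" "foldr (fp_cons H) v w = []"
    using Cons.IH w by blast
  have i: "[(x, inv\<^bsub>H\<^esub> h)] \<in> reduced_words H X" using x by (auto simp: reduced_words_def)
  have "foldr (fp_cons H) (foldr (fp_cons H) v [(x, inv\<^bsub>H\<^esub> h)]) (p # w) = []"
    using foldr_fp_cons_assoc[OF assms(1) v(1) i Cons.prems] v x p by simp
  moreover have "foldr (fp_cons H) v [(x, inv\<^bsub>H\<^esub> h)] \<in> reduced_words H X"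
    using foldr_fp_cons_reduced[OF assms(1) reduced_words_letters[OF v(1)] i] .
  ultimately show ?case by blast
qed

lemma group_free_product:
  assumes "group H"
  shows "group (free_product H X)"
proof (rule groupI)
  fix u v assume "u \<in> carrier (free_product H X)" "v \<in> carrier (free_product H X)"
  then show "u \<otimes>\<^bsub>free_product H X\<^esub> v \<in> carrier (free_product H X)"
    using foldr_fp_cons_reduced[OF assms reduced_words_letters] by (simp add: free_product_def)
next
  show "\<one>\<^bsub>free_product H X\<^esub> \<in> carrier (free_product H X)"
    by (simp add: free_product_def reduced_words_def)
qed (use assms foldr_fp_cons_assoc[OF assms] fp_left_inv[OF assms] in
      \<open>auto simp: free_product_def\<close>)

section \<open>Words and verbal subgroups\<close>

text \<open>
  The free group on \<open>x\<^sub>1, x\<^sub>2, \<dots>\<close> is the free product of infinite cyclic groups indexed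
  by the positive integers; the letter \<open>(i, n)\<close> is the power \<open>x\<^sub>i\<^sup>n\<close>.
\<close>

definition free_group_inf :: "(nat \<times> int) list monoid" where
  "free_group_inf = free_product integer_group {1..}"

definition free_gen :: "nat \<Rightarrow> (nat \<times> int) list" where
  "free_gen i = [(i, 1)]"

definition commutator :: "('a, 'b) monoid_scheme \<Rightarrow> 'a \<Rightarrow> 'a \<Rightarrow> 'a" where
  "commutator G a b = inv\<^bsub>G\<^esub> a \<otimes>\<^bsub>G\<^esub> inv\<^bsub>G\<^esub> b \<otimes>\<^bsub>G\<^esub> a \<otimes>\<^bsub>G\<^esub> b"

text \<open>\<open>n_word k\<close> is meaningful for \<open>k \<ge> 1\<close> only; the value at \<open>0\<close> is a dummy.\<close>

fun n_word :: "nat \<Rightarrow> (nat \<times> int) list" where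
  "n_word 0 = \<one>\<^bsub>free_group_inf\<^esub>"
| "n_word (Suc 0) = commutator free_group_inf (free_gen 2) (free_gen 1)"
| "n_word (Suc (Suc k)) = commutator free_group_inf (free_gen (k + 3)) (n_word (Suc k))"

definition word_value :: "('a, 'b) monoid_scheme \<Rightarrow> (nat \<Rightarrow> 'a) \<Rightarrow> (nat \<times> int) list \<Rightarrow> 'a" where
  "word_value G a w = foldr (\<lambda>(i, n) v. (a i [^]\<^bsub>G\<^esub> n) \<otimes>\<^bsub>G\<^esub> v) w \<one>\<^bsub>G\<^esub>"

definition verbal_subgroup :: "('a, 'b) monoid_scheme \<Rightarrow> (nat \<times> int) list set \<Rightarrow> 'a set" where
  "verbal_subgroup G W = generate G {word_value G a w | a w. a \<in> {1..} \<rightarrow> carrier G \<and> w \<in> W}"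

section \<open>Verbal products and verbal wreath products\<close>

definition normal_closure :: "('a, 'b) monoid_scheme \<Rightarrow> 'a set \<Rightarrow> 'a set" where
  "normal_closure G S = \<Inter> {N. N \<lhd> G \<and> S \<subseteq> N}"

definition copies_commutator :: "('h, 'b) monoid_scheme \<Rightarrow> 'x set \<Rightarrow> ('x \<times> 'h) list set" where
  "copies_commutator H X = normal_closure (free_product H X)
    {commutator (free_product H X) (fp_incl H x h) (fp_incl H y k) | x y h k.
      x \<in> X \<and> y \<in> X \<and> x \<noteq> y \<and> h \<in> carrier H \<and> k \<in> carrier H}"

definition verbal_product ::
    "(nat \<times> int) list set \<Rightarrow> ('h, 'b) monoid_scheme \<Rightarrow> 'x set \<Rightarrow> ('x \<times> 'h) list set monoid" where
  "verbal_product W H X = free_product H X Mod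
    (verbal_subgroup (free_product H X) W \<inter> copies_commutator H X)"

definition semidirect_product ::
    "('n, 'b) monoid_scheme \<Rightarrow> ('g, 'c) monoid_scheme \<Rightarrow> ('g \<Rightarrow> 'n \<Rightarrow> 'n) \<Rightarrow> ('n \<times> 'g) monoid" where
  "semidirect_product N G \<theta> =
    \<lparr>carrier = carrier N \<times> carrier G,
     monoid.mult = (\<lambda>(n, g) (m, h). (n \<otimes>\<^bsub>N\<^esub> \<theta> g m, g \<otimes>\<^bsub>G\<^esub> h)),
     one = (\<one>\<^bsub>N\<^esub>, \<one>\<^bsub>G\<^esub>)\<rparr>"

text \<open>
  Relabelling letters along the bijection \<open>\<alpha> g\<close> maps reduced words to reduced words; the induced map
  on the quotient is the image map on cosets.
\<close>

definition induced_action :: "('g \<Rightarrow> 'x \<Rightarrow> 'x) \<Rightarrow> 'g \<Rightarrow> ('x \<times> 'h) list set \<Rightarrow> ('x \<times> 'h) list set" where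
  "induced_action \<alpha> g C = map (\<lambda>(x, h). (\<alpha> g x, h)) ` C"

definition verbal_wreath_product ::
    "(nat \<times> int) list set \<Rightarrow> ('h, 'b) monoid_scheme \<Rightarrow> ('g, 'c) monoid_scheme \<Rightarrow> 'x set \<Rightarrow>
     ('g \<Rightarrow> 'x \<Rightarrow> 'x) \<Rightarrow> (('x \<times> 'h) list set \<times> 'g) monoid" where
  "verbal_wreath_product W H \<Gamma> X \<alpha> =
    semidirect_product (verbal_product W H X) \<Gamma> (induced_action \<alpha>)"

section \<open>Local embeddability into finite groups and finite actions\<close>

text \<open>
  Quantification over finite groups and finite sets is quantification over those carried by
  subsets of \<^typ>\<open>nat\<close>; up to isomorphism these are all of them.
\<close>

definition LEF_group :: "('g, 'b) monoid_scheme \<Rightarrow> bool" where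
  "LEF_group \<Gamma> \<longleftrightarrow> group \<Gamma> \<and>
    (\<forall>A. finite A \<and> A \<subseteq> carrier \<Gamma> \<longrightarrow>
      (\<exists>(Q :: nat monoid) \<phi>. group Q \<and> finite (carrier Q) \<and>
        \<phi> \<in> A \<rightarrow> carrier Q \<and> inj_on \<phi> A \<and>
        (\<forall>g\<in>A. \<forall>h\<in>A. g \<otimes>\<^bsub>\<Gamma>\<^esub> h \<in> A \<longrightarrow> \<phi> (g \<otimes>\<^bsub>\<Gamma>\<^esub> h) = \<phi> g \<otimes>\<^bsub>Q\<^esub> \<phi> h)))"

text \<open>
  \<open>\<rho>\<close> is not required to be injective, so a LEF action need not be an action of a LEF group: every
  group acts trivially on every set by a LEF action.
\<close>

definition LEF_action :: "('g, 'b) monoid_scheme \<Rightarrow> 'x set \<Rightarrow> ('g \<Rightarrow> 'x \<Rightarrow> 'x) \<Rightarrow> bool" where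
  "LEF_action \<Gamma> X \<alpha> \<longleftrightarrow> group_action \<Gamma> X \<alpha> \<and>
    (\<forall>F Z. finite F \<and> F \<subseteq> carrier \<Gamma> \<and> finite Z \<and> Z \<subseteq> X \<longrightarrow>
      (\<exists>(Q :: nat monoid) (Y :: nat set) \<beta> \<rho> \<pi>.
        group Q \<and> finite (carrier Q) \<and> finite Y \<and> group_action Q Y \<beta> \<and>
        \<rho> \<in> carrier \<Gamma> \<rightarrow> carrier Q \<and> \<pi> \<in> Z \<rightarrow> Y \<and> inj_on \<pi> Z \<and>
        (\<forall>g\<in>F. \<forall>h\<in>F. g \<otimes>\<^bsub>\<Gamma>\<^esub> h \<in> F \<longrightarrow> \<rho> (g \<otimes>\<^bsub>\<Gamma>\<^esub> h) = \<rho> g \<otimes>\<^bsub>Q\<^esub> \<rho> h) \<and>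
        (\<forall>g\<in>F. \<forall>x\<in>Z. \<alpha> g x \<in> Z \<longrightarrow> \<pi> (\<alpha> g x) = \<beta> (\<rho> g) (\<pi> x))))"

end

theory Submission
  imports Defs "HOL-Algebra.Multiplicative_Group"
begin

text \<open>
  The values of \<open>n\<^sub>k\<close> generate \<open>\<gamma>\<^sub>k\<^sub>+\<^sub>1\<close>. For finite \<open>Y\<close> the group \<open>F\<^sup>W(H, Y)\<close> is finite: \<open>F/[H]\<^sup>F\<close> is
  generated by a finite conjugation-invariant set of torsion elements, hence finite by Dietzmann's
  lemma, and \<open>\<gamma>\<^sub>c\<^sub>+\<^sub>1 \<inter> [H]\<^sup>F\<close> is central modulo \<open>\<gamma>\<^sub>c\<^sub>+\<^sub>2 \<inter> [H]\<^sup>F\<close>, so that a generator has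
  finitely many conjugates there and Dietzmann's lemma applies again.

  Given a finite \<open>A \<subseteq> H \<wr>\<^sup>W \<Gamma>\<close>, choose a finite \<open>Z \<subseteq> X\<close> supporting representatives of the
  elements of \<open>A\<close> and their translates, a finite model \<open>Q\<close> acting on \<open>Y\<close> of the action on \<open>Z\<close>,
  and a finite local model \<open>Q'\<close> of \<open>\<Gamma>\<close>, which restores the injectivity that \<open>\<rho>\<close> may lack. The
  injection \<open>\<pi> : Z \<rightarrow> Y\<close> induces a homomorphism \<open>F\<^sup>W(H, X) \<rightarrow> F\<^sup>W(H, Y)\<close> killing the copies outside
  \<open>Z\<close>; the partial inverse of \<open>\<pi>\<close> induces a left inverse on \<open>A\<close>. This gives a local embedding of
  \<open>A\<close> into the finite group \<open>F\<^sup>W(H, Y) \<rtimes> (Q \<times> Q')\<close>.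
\<close>

section \<open>Finiteness of groups generated by torsion elements\<close>

context group
begin

lemma foldr_mult_closed: "set l \<subseteq> carrier G \<Longrightarrow> foldr (\<otimes>) l \<one> \<in> carrier G"
  by (induction l) auto

lemma foldr_mult_append:
  "set l \<subseteq> carrier G \<Longrightarrow> set m \<subseteq> carrier G \<Longrightarrow>
    foldr (\<otimes>) (l @ m) \<one> = foldr (\<otimes>) l \<one> \<otimes> foldr (\<otimes>) m \<one>"
  by (induction l) (auto simp: m_assoc foldr_mult_closed)

lemma foldr_mult_replicate: "s \<in> carrier G \<Longrightarrow> foldr (\<otimes>) (replicate n s) \<one> = s [^] n"
  by (induction n) (simp_all flip: nat_pow_Suc2)

lemma conj_nat_pow:
  assumes "g \<in> carrier G" "t \<in> carrier G"
  shows "(inv g \<otimes> t \<otimes> g) [^] (n::nat) = inv g \<otimes> t [^] n \<otimes> g"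
proof (induction n)
  case (Suc n)
  have "g \<otimes> (inv g \<otimes> x) = x" if "x \<in> carrier G" for x
    using that assms by (simp flip: m_assoc)
  then show ?case using Suc assms by (simp add: m_assoc)
qed (use assms in simp)

lemma conj_pow_mem:
  assumes "S \<subseteq> carrier G" "\<And>a s. a \<in> S \<Longrightarrow> s \<in> S \<Longrightarrow> inv s \<otimes> a \<otimes> s \<in> S" "a \<in> S" "s \<in> S"
  shows "inv (s [^] (j::nat)) \<otimes> a \<otimes> s [^] j \<in> S"
proof (induction j)
  case 0
  then show ?case using assms by auto
next
  case (Suc j)
  have "a \<in> carrier G" "s \<in> carrier G" using assms by auto
  then have "inv (s [^] Suc j) \<otimes> a \<otimes> s [^] Suc j = inv s \<otimes> (inv (s [^] j) \<otimes> a \<otimes> s [^] j) \<otimes> s"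
    by (simp add: inv_mult_group m_assoc)
  then show ?case using assms(2)[OF Suc assms(4)] by simp
qed

text \<open>Moving an occurrence of \<open>s\<close> to the front replaces each letter it passes by
  a conjugate, which is again a letter of \<open>S\<close>. So the remaining word is shortened by
  exactly the number of collected occurrences. Any \<open>j\<close> up to the count is allowed, so
  that exactly \<open>e\<close> of them can be taken out later.\<close>

lemma collect_letter:
  assumes S: "S \<subseteq> carrier G" "\<And>a s. a \<in> S \<Longrightarrow> s \<in> S \<Longrightarrow> inv s \<otimes> a \<otimes> s \<in> S" and "s \<in> S"
  shows "set l \<subseteq> S \<Longrightarrow> j \<le> count_list l s \<Longrightarrow>
    \<exists>l'. set l' \<subseteq> S \<and> length l' + j = length l \<and> foldr (\<otimes>) l \<one> = s [^] j \<otimes> foldr (\<otimes>) l' \<one>"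
proof (induction l arbitrary: j)
  case Nil
  then show ?case by simp
next
  case (Cons a l)
  have sc: "s \<in> carrier G" and ac: "a \<in> carrier G" using assms Cons.prems by auto
  show ?case
  proof (cases "a = s \<and> j > 0")
    case True
    then have "j - 1 \<le> count_list l s" using Cons.prems by auto
    then obtain l' where l': "set l' \<subseteq> S" "length l' + (j - 1) = length l"
      "foldr (\<otimes>) l \<one> = s [^] (j - 1) \<otimes> foldr (\<otimes>) l' \<one>"
      using Cons.IH[of "j - 1"] Cons.prems(1) by auto
    have "foldr (\<otimes>) l' \<one> \<in> carrier G" using l' S by (intro foldr_mult_closed) auto
    then have "foldr (\<otimes>) (a # l) \<one> = s [^] (Suc (j - 1)) \<otimes> foldr (\<otimes>) l' \<one>"
      unfolding nat_pow_Suc2[OF sc] using l'(3) True sc by (simp add: m_assoc)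
    then show ?thesis using l' True by (intro exI[of _ l']) auto
  next
    case False
    then have "j \<le> count_list l s" using Cons.prems by (auto split: if_splits)
    then obtain l' where l': "set l' \<subseteq> S" "length l' + j = length l"
      "foldr (\<otimes>) l \<one> = s [^] j \<otimes> foldr (\<otimes>) l' \<one>"
      using Cons.IH[of j] Cons.prems(1) by auto
    \<comment> \<open>The letter that replaces \<open>a\<close> once the power of \<open>s\<close>
      collected from the tail has moved past it.\<close>
    define b where "b = inv (s [^] j) \<otimes> a \<otimes> s [^] j"
    have b: "b \<in> S" unfolding b_def using conj_pow_mem[OF S _ assms(3)] Cons.prems by auto
    have c: "foldr (\<otimes>) l' \<one> \<in> carrier G" using l' S by (intro foldr_mult_closed) auto
    have "s [^] j \<otimes> b = a \<otimes> s [^] j"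
      unfolding b_def using sc ac by (simp flip: m_assoc)
    then have "foldr (\<otimes>) (a # l) \<one> = s [^] j \<otimes> foldr (\<otimes>) (b # l') \<one>"
      using l'(3) sc ac b c S by (auto simp flip: m_assoc)
    then show ?thesis using l' b by (intro exI[of _ "b # l'"]) auto
  qed
qed

text \<open>Dietzmann's lemma: moving \<open>e\<close> occurrences of a letter to the front makes them cancel, so
  every element is a product of fewer than \<open>e\<close> occurrences of each letter.\<close>

lemma finite_generate_conj_closed_torsion:
  assumes S: "S \<subseteq> carrier G" "\<And>a s. a \<in> S \<Longrightarrow> s \<in> S \<Longrightarrow> inv s \<otimes> a \<otimes> s \<in> S"
    and fin: "finite S" and e: "e > 0" "\<And>s. s \<in> S \<Longrightarrow> s [^] (e::nat) = \<one>"
  shows "finite (generate G S)"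
proof -
  have short: "\<exists>l'. set l' \<subseteq> S \<and> length l' \<le> card S * e \<and> foldr (\<otimes>) l' \<one> = foldr (\<otimes>) l \<one>"
    if "set l \<subseteq> S" for l
    using that
  proof (induction "length l" arbitrary: l rule: less_induct)
    case less
    show ?case
    proof (cases "\<exists>s\<in>S. e \<le> count_list l s")
      case False
      have "length l = sum (count_list l) S" using sum_count_set[OF less.prems fin] by simp
      also have "\<dots> \<le> card S * e"
        using sum_bounded_above[of S "count_list l" e] False by (auto simp: not_le less_imp_le)
      finally show ?thesis using less.prems by blast
    next
      case True
      then obtain s where s: "s \<in> S" "e \<le> count_list l s" by blast
      obtain l' where l': "set l' \<subseteq> S" "length l' + e = length l"
        "foldr (\<otimes>) l \<one> = s [^] e \<otimes> foldr (\<otimes>) l' \<one>"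
        using collect_letter[OF S s(1) less.prems s(2)] by blast
      have "foldr (\<otimes>) l' \<one> \<in> carrier G" using l' S by (intro foldr_mult_closed) auto
      then have "foldr (\<otimes>) l \<one> = foldr (\<otimes>) l' \<one>" using l' e s by simp
      then show ?thesis using less.hyps[of l'] l' e by auto
    qed
  qed
  have word: "\<exists>l. set l \<subseteq> S \<and> x = foldr (\<otimes>) l \<one>" if "x \<in> generate G S" for x
    using that
  proof (induction x rule: generate.induct)
    case one
    then show ?case by (intro exI[of _ "[]"]) simp
  next
    case (incl h)
    then show ?case using S by (intro exI[of _ "[h]"]) auto
  next
    case (inv h)
    then have h: "h \<in> carrier G" using S by auto
    \<comment> \<open>Torsion turns inverses into positive powers, so products of letters of
      \<open>S\<close> without inverses exhaust the generated subgroup.\<close>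
    have "h [^] (e - 1) \<otimes> h = \<one>" using e(1) e(2)[OF inv] by (cases e) auto
    then have "inv h = h [^] (e - 1)" using h by (simp add: inv_equality)
    also have "\<dots> = foldr (\<otimes>) (replicate (e - 1) h) \<one>" using h by (simp only: foldr_mult_replicate)
    finally show ?case using inv by (intro exI[of _ "replicate (e - 1) h"]) (simp add: set_replicate_conv_if del: foldr_replicate)
  next
    case (eng h1 h2)
    then obtain l m where "set l \<subseteq> S" "h1 = foldr (\<otimes>) l \<one>" "set m \<subseteq> S" "h2 = foldr (\<otimes>) m \<one>"
      by blast
    then show ?case using S by (intro exI[of _ "l @ m"]) (subst foldr_mult_append; auto)
  qed
  have "generate G S \<subseteq> (\<lambda>l. foldr (\<otimes>) l \<one>) ` {l. set l \<subseteq> S \<and> length l \<le> card S * e}"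
  proof
    fix x assume "x \<in> generate G S"
    then obtain l where "set l \<subseteq> S" "x = foldr (\<otimes>) l \<one>" using word by blast
    then obtain l' where "set l' \<subseteq> S" "length l' \<le> card S * e" "x = foldr (\<otimes>) l' \<one>"
      using short by metis
    then show "x \<in> (\<lambda>l. foldr (\<otimes>) l \<one>) ` {l. set l \<subseteq> S \<and> length l \<le> card S * e}" by blast
  qed
  then show ?thesis
    using finite_subset finite_lists_length_le[OF fin] by blast
qed

end

section \<open>Commutators and images in which a subgroup of finite index becomes central\<close>

lemma commutator_closed:
  "group G \<Longrightarrow> a \<in> carrier G \<Longrightarrow> b \<in> carrier G \<Longrightarrow> commutator G a b \<in> carrier G"
  by (simp add: commutator_def group.is_monoid monoid.m_closed)

lemma commutator_one:
  assumes "group G" "a \<in> carrier G"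
  shows "commutator G \<one>\<^bsub>G\<^esub> a = \<one>\<^bsub>G\<^esub>" "commutator G a \<one>\<^bsub>G\<^esub> = \<one>\<^bsub>G\<^esub>"
proof -
  interpret group G by fact
  show "commutator G \<one>\<^bsub>G\<^esub> a = \<one>\<^bsub>G\<^esub>" "commutator G a \<one>\<^bsub>G\<^esub> = \<one>\<^bsub>G\<^esub>"
    using assms by (simp_all add: commutator_def)
qed

lemma (in group) commutator_eq_one_iff:
  assumes "a \<in> carrier G" "b \<in> carrier G"
  shows "commutator G a b = \<one> \<longleftrightarrow> a \<otimes> b = b \<otimes> a"
proof -
  have "commutator G a b = inv (b \<otimes> a) \<otimes> (a \<otimes> b)"
    using assms by (simp add: commutator_def inv_mult_group m_assoc)
  then show ?thesis using assms by (metis inv_closed inv_equality inv_inv l_inv m_closed)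
qed

lemma (in group_hom) hom_commutator:
  "a \<in> carrier G \<Longrightarrow> b \<in> carrier G \<Longrightarrow> h (commutator G a b) = commutator H (h a) (h b)"
  by (simp add: commutator_def)

text \<open>The image of \<open>M\<close> being central, the conjugates of a generator depend only on the
  coset of \<open>M\<close>, so there are finitely many of them.\<close>

lemma (in group_hom) finite_image_if_central_finite_index:
  assumes T: "T \<subseteq> carrier G" "finite T" "generate G T = carrier G"
    and e: "e > 0" "\<And>t. t \<in> T \<Longrightarrow> t [^]\<^bsub>G\<^esub> (e::nat) = \<one>\<^bsub>G\<^esub>"
    and M: "subgroup M G" "finite (rcosets\<^bsub>G\<^esub> M)"
    and central: "\<And>g m. g \<in> carrier G \<Longrightarrow> m \<in> M \<Longrightarrow> h (commutator G g m) = \<one>\<^bsub>H\<^esub>"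
  shows "finite (h ` carrier G)"
proof -
  \<comment> \<open>\<open>S\<close> consists of all conjugates of images of generators. It is
    closed under conjugation and inherits the exponent \<open>e\<close> by construction; centrality
    enters only in the proof that it is finite.\<close>
  define S where "S = (\<lambda>(t, g). h (inv\<^bsub>G\<^esub> g \<otimes>\<^bsub>G\<^esub> t \<otimes>\<^bsub>G\<^esub> g)) ` (T \<times> carrier G)"
  have Mc: "m \<in> carrier G" if "m \<in> M" for m using that subgroup.subset[OF M(1)] by auto
  have comm: "h g \<otimes>\<^bsub>H\<^esub> h m = h m \<otimes>\<^bsub>H\<^esub> h g" if "g \<in> carrier G" "m \<in> M" for g m
    using central[OF that] Mc that by (simp add: hom_commutator H.commutator_eq_one_iff)
  \<comment> \<open>The factor \<open>h m\<close> commutes with \<open>h t\<close> and cancels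
    against its inverse, so the conjugate depends on the right coset of \<open>g\<close>
    alone.\<close>
  have coset: "h (inv\<^bsub>G\<^esub> (m \<otimes>\<^bsub>G\<^esub> g) \<otimes>\<^bsub>G\<^esub> t \<otimes>\<^bsub>G\<^esub> (m \<otimes>\<^bsub>G\<^esub> g)) = h (inv\<^bsub>G\<^esub> g \<otimes>\<^bsub>G\<^esub> t \<otimes>\<^bsub>G\<^esub> g)"
    if "m \<in> M" "g \<in> carrier G" "t \<in> carrier G" for m g t
  proof -
    have "inv\<^bsub>H\<^esub> h m \<otimes>\<^bsub>H\<^esub> (h t \<otimes>\<^bsub>H\<^esub> h m) = h t"
      using that Mc comm[of t m] by (simp flip: H.m_assoc)
    then have *: "inv\<^bsub>H\<^esub> h m \<otimes>\<^bsub>H\<^esub> (h t \<otimes>\<^bsub>H\<^esub> (h m \<otimes>\<^bsub>H\<^esub> h g)) = h t \<otimes>\<^bsub>H\<^esub> h g"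
      using that Mc by (simp flip: H.m_assoc)
    show ?thesis using that Mc * by (simp add: H.inv_mult_group H.m_assoc)
  qed
  \<comment> \<open>One chosen representative per coset suffices, which exhibits \<open>S\<close>
    inside the image of a finite set.\<close>
  have "S \<subseteq> (\<lambda>(t, C). h (inv\<^bsub>G\<^esub> (SOME g. g \<in> C) \<otimes>\<^bsub>G\<^esub> t \<otimes>\<^bsub>G\<^esub> (SOME g. g \<in> C))) ` (T \<times> rcosets\<^bsub>G\<^esub> M)"
  proof
    fix x assume "x \<in> S"
    then obtain t g where tg: "t \<in> T" "g \<in> carrier G" "x = h (inv\<^bsub>G\<^esub> g \<otimes>\<^bsub>G\<^esub> t \<otimes>\<^bsub>G\<^esub> g)"
      by (auto simp: S_def)
    define r where "r = (SOME g'. g' \<in> M #>\<^bsub>G\<^esub> g)"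
    have "r \<in> M #>\<^bsub>G\<^esub> g" unfolding r_def using G.rcos_self[OF tg(2) M(1)] by (rule someI)
    then obtain m where "m \<in> M" "r = m \<otimes>\<^bsub>G\<^esub> g" by (auto simp: r_coset_def)
    then have "x = h (inv\<^bsub>G\<^esub> r \<otimes>\<^bsub>G\<^esub> t \<otimes>\<^bsub>G\<^esub> r)" using tg coset T(1) by auto
    moreover have "M #>\<^bsub>G\<^esub> g \<in> rcosets\<^bsub>G\<^esub> M"
      using G.rcosetsI tg subgroup.subset[OF M(1)] by auto
    ultimately show "x \<in> (\<lambda>(t, C). h (inv\<^bsub>G\<^esub> (SOME g. g \<in> C) \<otimes>\<^bsub>G\<^esub> t \<otimes>\<^bsub>G\<^esub> (SOME g. g \<in> C))) `
        (T \<times> rcosets\<^bsub>G\<^esub> M)"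
      using tg(1) by (auto simp: r_def intro!: rev_image_eqI[of "(t, M #>\<^bsub>G\<^esub> g)"])
  qed
  then have finS: "finite S" using T(2) M(2) by (meson finite_SigmaI finite_imageI finite_subset)
  have Sc: "S \<subseteq> carrier H" using T(1) by (auto simp: S_def)
  have "finite (generate H S)"
  proof (rule H.finite_generate_conj_closed_torsion[OF Sc _ finS e(1)])
    fix a s assume as: "a \<in> S" "s \<in> S"
    obtain t g where a: "t \<in> T" "g \<in> carrier G" "a = h (inv\<^bsub>G\<^esub> g \<otimes>\<^bsub>G\<^esub> t \<otimes>\<^bsub>G\<^esub> g)"
      using as by (auto simp: S_def)
    obtain t' g' where "t' \<in> T" "g' \<in> carrier G" "s = h (inv\<^bsub>G\<^esub> g' \<otimes>\<^bsub>G\<^esub> t' \<otimes>\<^bsub>G\<^esub> g')"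
      using as by (auto simp: S_def)
    then obtain u where u: "u \<in> carrier G" "s = h u"
      using T(1) by (metis G.inv_closed G.m_closed subsetD)
    have "inv\<^bsub>H\<^esub> s \<otimes>\<^bsub>H\<^esub> a \<otimes>\<^bsub>H\<^esub> s =
        h (inv\<^bsub>G\<^esub> (g \<otimes>\<^bsub>G\<^esub> u) \<otimes>\<^bsub>G\<^esub> t \<otimes>\<^bsub>G\<^esub> (g \<otimes>\<^bsub>G\<^esub> u))"
      using a u T(1) by (auto simp: H.inv_mult_group H.m_assoc subset_iff)
    then show "inv\<^bsub>H\<^esub> s \<otimes>\<^bsub>H\<^esub> a \<otimes>\<^bsub>H\<^esub> s \<in> S" using a u by (auto simp: S_def)
  next
    fix s assume "s \<in> S"
    then obtain t g where a: "t \<in> T" "t \<in> carrier G" "g \<in> carrier G"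
      "s = h (inv\<^bsub>G\<^esub> g \<otimes>\<^bsub>G\<^esub> t \<otimes>\<^bsub>G\<^esub> g)"
      using T(1) by (auto simp: S_def)
    have "s [^]\<^bsub>H\<^esub> e = h ((inv\<^bsub>G\<^esub> g \<otimes>\<^bsub>G\<^esub> t \<otimes>\<^bsub>G\<^esub> g) [^]\<^bsub>G\<^esub> e)"
      unfolding a(4) by (rule hom_nat_pow[symmetric]) (use a in auto)
    then show "s [^]\<^bsub>H\<^esub> e = \<one>\<^bsub>H\<^esub>" using a e(2)[OF a(1)] by (simp add: G.conj_nat_pow)
  qed
  moreover have "h ` carrier G \<subseteq> generate H S"
  proof -
    have "h ` T \<subseteq> S"
    proof
      fix x assume "x \<in> h ` T"
      then obtain t where "t \<in> T" "x = h t" by auto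
      then show "x \<in> S" using T(1) by (auto simp: S_def intro!: rev_image_eqI[of "(t, \<one>\<^bsub>G\<^esub>)"])
    qed
    then show ?thesis using H.mono_generate[of "h ` T" S] generate_img[OF T(1)] T(3) by simp
  qed
  ultimately show ?thesis using finite_subset by blast
qed

section \<open>Homomorphisms out of a free product\<close>

lemma carrier_free_product [simp]: "carrier (free_product H X) = reduced_words H X"
  and mult_free_product [simp]: "monoid.mult (free_product H X) = foldr (fp_cons H)"
  and one_free_product [simp]: "\<one>\<^bsub>free_product H X\<^esub> = []"
  by (simp_all add: free_product_def)

lemma Nil_reduced_words [simp]: "[] \<in> reduced_words H X"
  by (simp add: reduced_words_def)

lemma fp_incl_reduced: "x \<in> X \<Longrightarrow> h \<in> carrier H \<Longrightarrow> fp_incl H x h \<in> reduced_words H X"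
  by (auto simp: reduced_words_def fp_incl_def)

lemma fp_incl_hom: "group H \<Longrightarrow> x \<in> X \<Longrightarrow> fp_incl H x \<in> hom H (free_product H X)"
  by (rule homI) (auto simp: fp_incl_reduced, auto simp: fp_incl_def group.is_monoid monoid.r_one monoid.l_one)

lemma reduced_words_ConsD:
  assumes "(x, h) # w \<in> reduced_words H X"
  shows "x \<in> X" "h \<in> carrier H" "h \<noteq> \<one>\<^bsub>H\<^esub>" "w \<in> reduced_words H X"
    "fp_incl H x h = [(x, h)]" "foldr (fp_cons H) (fp_incl H x h) w = (x, h) # w"
  using assms by (cases w; auto simp: reduced_words_def fp_incl_def successively_Cons)+

text \<open>Agreement is required only on the letters of the given word, because the relabellings
  compared later coincide on the support of a word but not on the whole index set.\<close>

lemma free_product_hom_eqI: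
  assumes "group H" "f \<in> hom (free_product H X) G" "g \<in> hom (free_product H X) G" "group G"
    and "w \<in> reduced_words H X"
    and "\<And>x h. (x, h) \<in> set w \<Longrightarrow> f (fp_incl H x h) = g (fp_incl H x h)"
  shows "f w = g w"
proof -
  interpret f: group_hom "free_product H X" G f
    using assms group_free_product by (simp add: group_hom_def group_hom_axioms_def)
  interpret g: group_hom "free_product H X" G g
    using assms group_free_product by (simp add: group_hom_def group_hom_axioms_def)
  show ?thesis using assms(5,6)
  proof (induction w)
    case Nil
    show ?case using f.hom_one g.hom_one by simp
  next
    case (Cons p w)
    obtain x h where p: "p = (x, h)" by (cases p)
    note * = reduced_words_ConsD[OF Cons.prems(1)[unfolded p]]
    have "f (foldr (fp_cons H) (fp_incl H x h) w) = g (foldr (fp_cons H) (fp_incl H x h) w)"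
      using f.hom_mult[of "fp_incl H x h" w] g.hom_mult[of "fp_incl H x h" w] *(4) Cons.IH
        Cons.prems(2) p fp_incl_reduced[OF *(1,2)] by simp
    then show ?case using * p by simp
  qed
qed

lemma generate_free_product:
  assumes "group H"
  shows "generate (free_product H X) (\<Union>x\<in>X. fp_incl H x ` carrier H) = carrier (free_product H X)"
    (is "generate ?F ?T = _")
proof
  interpret group ?F using assms by (rule group_free_product)
  show "generate ?F ?T \<subseteq> carrier ?F"
    by (rule generate_incl) (auto simp: fp_incl_reduced)
  show "carrier ?F \<subseteq> generate ?F ?T"
  proof
    fix w assume "w \<in> carrier ?F"
    then have "w \<in> reduced_words H X" by simp
    then show "w \<in> generate ?F ?T"
    proof (induction w)
      case Nil
      show ?case using generate.one[of ?F ?T] by simp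
    next
      case (Cons p w)
      obtain x h where p: "p = (x, h)" by (cases p)
      note * = reduced_words_ConsD[OF Cons.prems[unfolded p]]
      have "fp_incl H x h \<in> ?T" using *(1,2) by blast
      then have "fp_incl H x h \<otimes>\<^bsub>?F\<^esub> w \<in> generate ?F ?T"
        using * Cons.IH by (blast intro: generate.eng generate.incl)
      then show ?case using * p by simp
    qed
  qed
qed

text \<open>The homomorphism given by the universal property of the free product. As a fold it makes
  sense on every list of letters, reduced or not, and reads only the product and the unit of
  \<open>G\<close>.\<close>

definition fp_eval :: "('a, 'c) monoid_scheme \<Rightarrow> ('x \<Rightarrow> 'h \<Rightarrow> 'a) \<Rightarrow> ('x \<times> 'h) list \<Rightarrow> 'a" where
  "fp_eval G \<phi> w = foldr (\<lambda>(x, h) v. \<phi> x h \<otimes>\<^bsub>G\<^esub> v) w \<one>\<^bsub>G\<^esub>"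

context
  fixes H :: "('h, 'b) monoid_scheme" and G :: "('a, 'c) monoid_scheme" (structure) and X :: "'x set"
    and \<phi> :: "'x \<Rightarrow> 'h \<Rightarrow> 'a"
  assumes H: "group H" and G: "group G" and \<phi>: "\<And>x. x \<in> X \<Longrightarrow> \<phi> x \<in> hom H G"
begin

lemma fp_eval_closed: "set w \<subseteq> X \<times> carrier H \<Longrightarrow> fp_eval G \<phi> w \<in> carrier G"
proof (induction w)
  case Nil
  show ?case using G by (simp add: fp_eval_def group.is_monoid)
next
  case (Cons p w)
  then show ?case using G hom_carrier[OF \<phi>]
    by (auto simp: fp_eval_def group.is_monoid intro!: monoid.m_closed)
qed

text \<open>Merging or cancelling two letters of one copy does not change the evaluation, since each
  \<phi> \<open>x\<close> is a homomorphism.\<close>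

lemma fp_eval_fp_cons:
  assumes "x \<in> X" "h \<in> carrier H" "set w \<subseteq> X \<times> carrier H"
  shows "fp_eval G \<phi> (fp_cons H (x, h) w) = \<phi> x h \<otimes>\<^bsub>G\<^esub> fp_eval G \<phi> w"
proof -
  interpret group G by (rule G)
  interpret hx: group_hom H G "\<phi> x"
    using H G \<phi> assms(1) by (simp add: group_hom_def group_hom_axioms_def)
  show ?thesis
  proof (cases w)
    case Nil
    then show ?thesis using assms by (auto simp: fp_eval_def)
  next
    case (Cons p v)
    obtain y k where p: "p = (y, k)" by (cases p)
    have k: "y \<in> X" "k \<in> carrier H" "fp_eval G \<phi> v \<in> carrier G" "\<phi> x h \<in> carrier G"
      "fp_eval G \<phi> w \<in> carrier G"
      using assms Cons p fp_eval_closed[of v] fp_eval_closed[of w] by auto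
    have ev: "fp_eval G \<phi> ((z, l) # u) = \<phi> z l \<otimes> fp_eval G \<phi> u" for z l u
      by (simp add: fp_eval_def)
    have "\<phi> x h \<otimes> (\<phi> x k \<otimes> fp_eval G \<phi> v) = fp_eval G \<phi> v" if "h \<otimes>\<^bsub>H\<^esub> k = \<one>\<^bsub>H\<^esub>"
      using that k assms hx.hom_mult[of h k] by (simp flip: m_assoc)
    moreover have "\<phi> x (h \<otimes>\<^bsub>H\<^esub> k) \<otimes> fp_eval G \<phi> v = \<phi> x h \<otimes> (\<phi> x k \<otimes> fp_eval G \<phi> v)"
      using k assms by (simp add: m_assoc)
    ultimately show ?thesis using assms k Cons p by (cases "x = y") (auto simp: ev)
  qed
qed

text \<open>The product of the free product is an iterated \<open>fp_cons\<close>, so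
  multiplicativity follows by induction on the left factor.\<close>

lemma fp_eval_hom: "fp_eval G \<phi> \<in> hom (free_product H X) G"
proof (rule homI)
  fix u v assume uv: "u \<in> carrier (free_product H X)" "v \<in> carrier (free_product H X)"
  interpret group G by (rule G)
  have v: "set v \<subseteq> X \<times> carrier H" "v \<in> reduced_words H X"
    using uv reduced_words_letters by auto
  have "set u \<subseteq> X \<times> carrier H" using uv(1) reduced_words_letters by auto
  then have "fp_eval G \<phi> (foldr (fp_cons H) u v) = fp_eval G \<phi> u \<otimes>\<^bsub>G\<^esub> fp_eval G \<phi> v"
  proof (induction u)
    case Nil
    show ?case using fp_eval_closed[OF v(1)] by (simp add: fp_eval_def)
  next
    case (Cons p u)
    obtain x h where p: "p = (x, h)" by (cases p)
    have *: "x \<in> X" "h \<in> carrier H" "set u \<subseteq> X \<times> carrier H" using Cons.prems p by auto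
    have "set (foldr (fp_cons H) u v) \<subseteq> X \<times> carrier H"
      using foldr_fp_cons_reduced[OF H *(3) v(2)] by (rule reduced_words_letters)
    moreover have "\<phi> x h \<in> carrier G" using hom_carrier[OF \<phi>] * by auto
    moreover have "fp_eval G \<phi> ((x, h) # u) = \<phi> x h \<otimes> fp_eval G \<phi> u"
      by (simp add: fp_eval_def)
    ultimately show ?case
      using Cons.IH * p fp_eval_closed[OF *(3)] fp_eval_closed[OF v(1)]
      by (simp add: fp_eval_fp_cons m_assoc)
  qed
  then show "fp_eval G \<phi> (u \<otimes>\<^bsub>free_product H X\<^esub> v) = fp_eval G \<phi> u \<otimes>\<^bsub>G\<^esub> fp_eval G \<phi> v"
    by simp
qed (simp add: fp_eval_closed[OF reduced_words_letters])

lemma fp_eval_incl: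
  assumes "x \<in> X" "h \<in> carrier H"
  shows "fp_eval G \<phi> (fp_incl H x h) = \<phi> x h"
proof -
  interpret group G by (rule G)
  have "\<phi> x h \<in> carrier G" using hom_carrier[OF \<phi>] assms by auto
  then show ?thesis using hom_one[OF \<phi> H G] assms by (auto simp: fp_eval_def fp_incl_def)
qed

end

section \<open>Verbal subgroups and the cross-commutator subgroup\<close>

lemma normal_vimage:
  assumes "group_hom G H f" "N \<lhd> H"
  shows "{x \<in> carrier G. f x \<in> N} \<lhd> G"
proof -
  interpret group_hom G H f by fact
  interpret N: normal N H by fact
  show ?thesis
    by (rule G.normal_invI, rule G.subgroupI) (auto simp: N.inv_op_closed2 intro!: exI[of _ "\<one>\<^bsub>G\<^esub>"])
qed

lemma normal_closure_normal:
  assumes "group G" "S \<subseteq> carrier G"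
  shows "normal_closure G S \<lhd> G"
proof -
  interpret group G by fact
  have "carrier G \<lhd> G" by (rule normal_invI) (auto intro: subgroup_self)
  then have ne: "{N. N \<lhd> G \<and> S \<subseteq> N} \<noteq> {}" using assms by auto
  have "subgroup (normal_closure G S) G"
    unfolding normal_closure_def
    by (rule subgroups_Inter) (use ne normal_imp_subgroup in auto)
  then show ?thesis
    by (rule normal_invI) (auto simp: normal_closure_def normal_inv_iff)
qed

lemma subset_normal_closure: "S \<subseteq> normal_closure G S"
  by (auto simp: normal_closure_def)

lemma normal_closure_minimal: "N \<lhd> G \<Longrightarrow> S \<subseteq> N \<Longrightarrow> normal_closure G S \<subseteq> N"
  by (auto simp: normal_closure_def)

text \<open>Substitution into words is the universal property of the free group, seen as a free
  product of infinite cyclic groups: the factor with index \<open>i\<close> is mapped by the powers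
  of \<open>a i\<close>.\<close>

lemma word_value_eq_fp_eval: "word_value G a = fp_eval G (\<lambda>i n. a i [^]\<^bsub>G\<^esub> n)"
  by (rule ext) (simp add: word_value_def fp_eval_def)

lemma carrier_free_group_inf: "carrier free_group_inf = reduced_words integer_group {1..}"
  by (simp add: free_group_inf_def)

lemma group_free_group_inf: "group free_group_inf"
  unfolding free_group_inf_def by (rule group_free_product) simp

lemma word_value_hom:
  assumes "group G" "a \<in> {1..} \<rightarrow> carrier G"
  shows "word_value G a \<in> hom free_group_inf G"
  unfolding word_value_eq_fp_eval free_group_inf_def
  by (rule fp_eval_hom)
    (use assms in \<open>auto simp: Pi_iff intro!: homI group.int_pow_closed group.int_pow_mult\<close>)

lemma (in group_hom) hom_word_value:
  assumes "a \<in> {1..} \<rightarrow> carrier G" "w \<in> carrier free_group_inf"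
  shows "h (word_value G a w) = word_value H (h \<circ> a) w"
proof -
  have "set w \<subseteq> {1..} \<times> UNIV"
    using assms(2) reduced_words_letters[of w integer_group "{1..}"]
    by (auto simp: carrier_free_group_inf)
  \<comment> \<open>Membership in the carrier is carried through the induction because
    \<open>h\<close> is multiplicative on the carrier only.\<close>
  then have "word_value G a w \<in> carrier G \<and> ?thesis"
  proof (induction w)
    case (Cons p w)
    then show ?case using assms(1) by (auto simp: word_value_def hom_int_pow Pi_iff)
  qed (simp add: word_value_def)
  then show ?thesis by blast
qed

definition word_values :: "('a, 'b) monoid_scheme \<Rightarrow> (nat \<times> int) list set \<Rightarrow> 'a set" where
  "word_values G W = {word_value G a w | a w. a \<in> {1..} \<rightarrow> carrier G \<and> w \<in> W}"

lemma word_valuesI: "a \<in> {1..} \<rightarrow> carrier G \<Longrightarrow> w \<in> W \<Longrightarrow> word_value G a w \<in> word_values G W"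
  by (auto simp: word_values_def)

lemma verbal_subgroup_eq: "verbal_subgroup G W = generate G (word_values G W)"
  by (simp add: verbal_subgroup_def word_values_def)

lemma word_values_carrier:
  assumes "group G" "W \<subseteq> carrier free_group_inf"
  shows "word_values G W \<subseteq> carrier G"
  using hom_carrier[OF word_value_hom[OF assms(1)]] assms(2) by (fastforce simp: word_values_def)

lemma (in group_hom) hom_word_values:
  assumes "W \<subseteq> carrier free_group_inf"
  shows "h ` word_values G W \<subseteq> word_values H W"
proof
  fix y assume "y \<in> h ` word_values G W"
  then obtain a w where aw: "a \<in> {1..} \<rightarrow> carrier G" "w \<in> W" "y = h (word_value G a w)"
    by (auto simp: word_values_def)
  then have "y = word_value H (h \<circ> a) w" using hom_word_value assms by blast
  moreover have "h \<circ> a \<in> {1..} \<rightarrow> carrier H" using aw by (auto simp: Pi_iff)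
  ultimately show "y \<in> word_values H W" using aw unfolding word_values_def by blast
qed

lemma (in group_hom) hom_verbal_subgroup:
  assumes "W \<subseteq> carrier free_group_inf"
  shows "h ` verbal_subgroup G W \<subseteq> verbal_subgroup H W"
  using H.mono_generate[OF hom_word_values[OF assms]]
    generate_img[OF word_values_carrier[OF G.is_group assms]]
  by (simp add: verbal_subgroup_eq)

text \<open>Inner automorphisms are homomorphisms, so they map values of words to values of words.
  The generating set is therefore invariant under conjugation.\<close>

lemma verbal_subgroup_normal:
  fixes G (structure)
  assumes "group G" "W \<subseteq> carrier free_group_inf"
  shows "verbal_subgroup G W \<lhd> G"
proof -
  interpret group G by fact
  have "g \<otimes> h \<otimes> inv g \<in> word_values G W" if "h \<in> word_values G W" "g \<in> carrier G" for h g
  proof -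
    have cancel: "inv g \<otimes> (g \<otimes> x) = x" if "x \<in> carrier G" for x
      using that \<open>g \<in> carrier G\<close> by (simp flip: m_assoc)
    have "group_hom G G (\<lambda>x. g \<otimes> x \<otimes> inv g)"
      using that(2) by unfold_locales (auto intro!: homI simp: m_assoc cancel)
    from group_hom.hom_word_values[OF this assms(2)] that(1) show ?thesis by auto
  qed
  then show ?thesis
    unfolding verbal_subgroup_eq
    using normal_generateI[OF word_values_carrier[OF assms]] by blast
qed

section \<open>The words \<open>n_word k\<close> as iterated commutators\<close>

lemma free_gen_carrier: "i \<ge> 1 \<Longrightarrow> free_gen i \<in> carrier free_group_inf"
  by (auto simp: carrier_free_group_inf free_gen_def reduced_words_def)

lemma n_word_carrier: "n_word k \<in> carrier free_group_inf"
  by (induction k rule: n_word.induct)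
    (auto intro!: commutator_closed group_free_group_inf free_gen_carrier
      simp: group.is_monoid[OF group_free_group_inf])

lemma n_word_singleton_carrier: "{n_word k} \<subseteq> carrier free_group_inf"
  using n_word_carrier by simp

lemma word_value_commutator:
  assumes "group G" "a \<in> {1..} \<rightarrow> carrier G" "u \<in> carrier free_group_inf" "v \<in> carrier free_group_inf"
  shows "word_value G a (commutator free_group_inf u v) = commutator G (word_value G a u) (word_value G a v)"
proof -
  interpret group_hom free_group_inf G "word_value G a"
    using assms group_free_group_inf word_value_hom by (simp add: group_hom_def group_hom_axioms_def)
  show ?thesis using assms by (simp add: hom_commutator)
qed

lemma word_value_free_gen: "group G \<Longrightarrow> i \<ge> 1 \<Longrightarrow> a \<in> {1..} \<rightarrow> carrier G \<Longrightarrow> word_value G a (free_gen i) = a i"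
  by (auto simp: word_value_def free_gen_def group.int_pow_1 group.is_monoid Pi_iff monoid.r_one)

text \<open>The recursion of the words passes to their values. Its second clause starts at 1 since
  \<open>n_word 0\<close> is a dummy; the variable newly brought in by \<open>n_word (Suc k)\<close>
  has index \<open>k + 2\<close>.\<close>

lemma word_value_n_word:
  assumes "group G" "a \<in> {1..} \<rightarrow> carrier G"
  shows "word_value G a (n_word (Suc 0)) = commutator G (a 2) (a 1)"
    and "k \<ge> 1 \<Longrightarrow> word_value G a (n_word (Suc k)) = commutator G (a (k + 2)) (word_value G a (n_word k))"
  using assms by (simp_all add: word_value_commutator free_gen_carrier word_value_free_gen)
    (cases k; simp add: eval_nat_numeral word_value_commutator free_gen_carrier word_value_free_gen n_word_carrier del: n_word.simps(1))

section \<open>Verbal products of finitely many copies of a finite group\<close>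

lemma (in normal) group_hom_Mod: "group_hom G (G Mod H) (\<lambda>a. H #> a)"
  using r_coset_hom_Mod factorgroup_is_group is_group by (simp add: group_hom_def group_hom_axioms_def)

lemma (in normal) rcos_eq_one_iff: "x \<in> carrier G \<Longrightarrow> H #> x = \<one>\<^bsub>G Mod H\<^esub> \<longleftrightarrow> x \<in> H"
  using coset_join1[OF _ _ subgroup_axioms] coset_join2[OF _ subgroup_axioms] by auto

text \<open>The elements whose images commute with \<open>h g\<close> are closed under products and
  inverses, so commuting need only be checked on generators.\<close>

lemma (in group_hom) hom_commutator_generate:
  assumes "S \<subseteq> carrier G" and "\<And>s. s \<in> S \<Longrightarrow> h (commutator G g s) = \<one>\<^bsub>H\<^esub>"
    and g: "g \<in> carrier G" and "m \<in> generate G S"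
  shows "h (commutator G g m) = \<one>\<^bsub>H\<^esub>"
proof -
  have iff: "h (commutator G g x) = \<one>\<^bsub>H\<^esub> \<longleftrightarrow> h g \<otimes>\<^bsub>H\<^esub> h x = h x \<otimes>\<^bsub>H\<^esub> h g" if "x \<in> carrier G" for x
    using that g by (simp add: hom_commutator H.commutator_eq_one_iff)
  have "m \<in> carrier G \<and> h g \<otimes>\<^bsub>H\<^esub> h m = h m \<otimes>\<^bsub>H\<^esub> h g"
    using assms(4)
  proof (induction m rule: generate.induct)
    case one
    then show ?case using g by simp
  next
    case (incl x)
    then show ?case using assms(1,2) iff by auto
  next
    case (inv x)
    then have x: "x \<in> carrier G" "h g \<otimes>\<^bsub>H\<^esub> h x = h x \<otimes>\<^bsub>H\<^esub> h g"
      using assms(1,2) iff by auto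
    have "h x \<in> carrier H" "h g \<in> carrier H" using x g by auto
    then have "h g \<otimes>\<^bsub>H\<^esub> inv\<^bsub>H\<^esub> h x = inv\<^bsub>H\<^esub> h x \<otimes>\<^bsub>H\<^esub> h g"
      using x(2) by (metis H.inv_closed H.inv_solve_left' H.inv_solve_right' H.m_assoc H.m_closed)
    then show ?case using x by simp
  next
    case (eng x y)
    then have "x \<in> carrier G" "y \<in> carrier G"
      "h g \<otimes>\<^bsub>H\<^esub> h x = h x \<otimes>\<^bsub>H\<^esub> h g" "h g \<otimes>\<^bsub>H\<^esub> h y = h y \<otimes>\<^bsub>H\<^esub> h g" by auto
    then show ?case using g by (metis G.m_closed H.m_assoc hom_closed hom_mult)
  qed
  then show ?thesis using iff by blast
qed

lemma (in normal) commutator_mem: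
  assumes "g \<in> carrier G" "m \<in> H"
  shows "commutator G g m \<in> H"
proof -
  have m: "m \<in> carrier G" using assms subset by auto
  have "inv g \<otimes> inv m \<otimes> g \<in> H" using assms inv_op_closed1 by auto
  then show ?thesis unfolding commutator_def using assms by blast
qed

lemma copies_commutator_normal:
  assumes "group H"
  shows "copies_commutator H X \<lhd> free_product H X"
  unfolding copies_commutator_def
  by (rule normal_closure_normal)
    (use commutator_closed[OF group_free_product[OF assms], of _ X] assms in
      \<open>auto simp: group_free_product fp_incl_reduced\<close>)

lemma commutator_fp_incl_mem:
  assumes "x \<in> X" "y \<in> X" "x \<noteq> y" "h \<in> carrier H" "k \<in> carrier H"
  shows "commutator (free_product H X) (fp_incl H x h) (fp_incl H y k) \<in> copies_commutator H X"
  using assms subset_normal_closure[of _ "free_product H X"] unfolding copies_commutator_def by fast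

definition verbal_kernel ::
    "(nat \<times> int) list set \<Rightarrow> ('h, 'b) monoid_scheme \<Rightarrow> 'x set \<Rightarrow> ('x \<times> 'h) list set" where
  "verbal_kernel W H X = verbal_subgroup (free_product H X) W \<inter> copies_commutator H X"

lemma verbal_product_eq: "verbal_product W H X = free_product H X Mod verbal_kernel W H X"
  by (simp add: verbal_product_def verbal_kernel_def)

lemma verbal_kernel_normal:
  assumes "group H" "W \<subseteq> carrier free_group_inf"
  shows "verbal_kernel W H X \<lhd> free_product H X"
  unfolding verbal_kernel_def
  using assms by (intro group.normal_subgroup_intersect verbal_subgroup_normal
      copies_commutator_normal group_free_product)

lemma fp_incl_pow_order:
  assumes "group H" "x \<in> X" "h \<in> carrier H"
  shows "fp_incl H x h [^]\<^bsub>free_product H X\<^esub> order H = \<one>\<^bsub>free_product H X\<^esub>"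
proof -
  interpret group_hom H "free_product H X" "fp_incl H x"
    using assms group_free_product[of H X] fp_incl_hom[of H x X]
    by (simp add: group_hom_def group_hom_axioms_def)
  show ?thesis
    using hom_nat_pow[OF assms(3), of "order H"] G.pow_order_eq_1[OF assms(3)] hom_one by simp
qed

text \<open>Modulo the cross-commutators, conjugation by an element of another copy is trivial, and
  conjugation within a copy stays in it. The images of the finitely many copies thus form a finite
  set closed under conjugation, with exponent \<open>order H\<close>, and Dietzmann's lemma
  applies.\<close>

lemma finite_free_product_Mod_copies_commutator:
  assumes "group H" "finite (carrier H)" "finite X"
  shows "finite (carrier (free_product H X Mod copies_commutator H X))"
proof -
  define F where "F = free_product H X"
  define N where "N = copies_commutator H X"
  define q where "q = (\<lambda>w. N #>\<^bsub>F\<^esub> w)"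
  interpret N: normal N F unfolding N_def F_def by (rule copies_commutator_normal) fact
  interpret q: group_hom F "F Mod N" q unfolding q_def by (rule N.group_hom_Mod)
  interpret H: group H by fact
  define T where "T = (\<Union>x\<in>X. fp_incl H x ` carrier H)"
  have incl: "fp_incl H x h \<in> carrier F" if "x \<in> X" "h \<in> carrier H" for x h
    using that by (simp add: F_def fp_incl_reduced)
  have Tc: "T \<subseteq> carrier F" using incl by (auto simp: T_def)
  have "finite (generate (F Mod N) (q ` T))"
  proof (rule q.H.finite_generate_conj_closed_torsion)
    show "q ` T \<subseteq> carrier (F Mod N)" using Tc by auto
    show "finite (q ` T)" using assms by (simp add: T_def)
    show "order H > 0" using assms by (simp add: H.order_gt_0_iff_finite)
    fix s assume "s \<in> q ` T"
    then obtain x h where s: "x \<in> X" "h \<in> carrier H" "s = q (fp_incl H x h)" by (auto simp: T_def)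
    show "s [^]\<^bsub>F Mod N\<^esub> order H = \<one>\<^bsub>F Mod N\<^esub>"
      using q.hom_nat_pow[OF incl[OF s(1,2)], of "order H"] fp_incl_pow_order[OF assms(1) s(1,2)]
        q.hom_one s(3) by (simp add: F_def)
  next
    fix a s assume "a \<in> q ` T" "s \<in> q ` T"
    then obtain x h y k where a: "x \<in> X" "h \<in> carrier H" "a = q (fp_incl H x h)"
      and s: "y \<in> X" "k \<in> carrier H" "s = q (fp_incl H y k)" by (auto simp: T_def)
    note c = incl[OF a(1,2)] incl[OF s(1,2)]
    show "inv\<^bsub>F Mod N\<^esub> s \<otimes>\<^bsub>F Mod N\<^esub> a \<otimes>\<^bsub>F Mod N\<^esub> s \<in> q ` T"
    proof (cases "x = y")
      case True
      interpret i: group_hom H F "fp_incl H x"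
        using assms a fp_incl_hom[of H x X] N.is_group
        by (simp add: group_hom_def group_hom_axioms_def F_def)
      have "inv\<^bsub>F Mod N\<^esub> s \<otimes>\<^bsub>F Mod N\<^esub> a \<otimes>\<^bsub>F Mod N\<^esub> s =
          q (fp_incl H x (inv\<^bsub>H\<^esub> k \<otimes>\<^bsub>H\<^esub> h \<otimes>\<^bsub>H\<^esub> k))"
        unfolding a(3) s(3) True[symmetric]
        using a(1,2) s(2) incl[OF a(1,2)] incl[OF a(1) s(2)] by (simp del: mult_FactGroup)
      moreover have "fp_incl H x (inv\<^bsub>H\<^esub> k \<otimes>\<^bsub>H\<^esub> h \<otimes>\<^bsub>H\<^esub> k) \<in> T"
        unfolding T_def using a(1,2) s(2) by (blast intro: H.m_closed H.inv_closed)
      ultimately show ?thesis by simp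
    next
      case False
      have "q (commutator F (fp_incl H x h) (fp_incl H y k)) = \<one>\<^bsub>F Mod N\<^esub>"
        using commutator_fp_incl_mem[OF a(1) s(1) False a(2) s(2)] c
          N.rcos_eq_one_iff[OF commutator_closed[OF N.is_group c]]
        by (simp add: q_def F_def N_def del: one_FactGroup)
      then have "a \<otimes>\<^bsub>F Mod N\<^esub> s = s \<otimes>\<^bsub>F Mod N\<^esub> a"
        using a s c by (simp add: q.hom_commutator q.H.commutator_eq_one_iff
            del: one_FactGroup mult_FactGroup)
      moreover have "a \<in> carrier (F Mod N)" "s \<in> carrier (F Mod N)" using a s c by auto
      ultimately have "inv\<^bsub>F Mod N\<^esub> s \<otimes>\<^bsub>F Mod N\<^esub> a \<otimes>\<^bsub>F Mod N\<^esub> s = a"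
        by (metis q.H.inv_closed q.H.m_assoc q.H.l_inv q.H.l_one)
      then show ?thesis using a by (auto simp: T_def)
    qed
  qed
  moreover have "generate (F Mod N) (q ` T) = q ` carrier F"
    using q.generate_img[OF Tc] generate_free_product[OF assms(1), of X]
    by (simp add: T_def F_def)
  ultimately show ?thesis
    by (simp add: carrier_FactGroup F_def N_def q_def)
qed

text \<open>The common part of the base case and the induction step. A commutator with an element of
  \<open>M\<close> lies in the verbal subgroup by hypothesis and in
  \<open>copies_commutator H X\<close> by normality, hence in the kernel. So \<open>M\<close> has
  finite index and becomes central in the verbal product.\<close>

lemma finite_verbal_product_step:
  assumes H: "group H" "finite (carrier H)" and X: "finite X" and W: "W \<subseteq> carrier free_group_inf"
    and M: "subgroup M (free_product H X)" "finite (rcosets\<^bsub>free_product H X\<^esub> M)"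
      "M \<subseteq> copies_commutator H X"
    and comm: "\<And>g m. g \<in> carrier (free_product H X) \<Longrightarrow> m \<in> M \<Longrightarrow>
      commutator (free_product H X) g m \<in> verbal_subgroup (free_product H X) W"
  shows "finite (carrier (verbal_product W H X))"
proof -
  define F where "F = free_product H X"
  define K where "K = verbal_kernel W H X"
  interpret K: normal K F unfolding K_def F_def by (rule verbal_kernel_normal) fact+
  interpret C: normal "copies_commutator H X" F
    unfolding F_def by (rule copies_commutator_normal) fact
  interpret q: group_hom F "F Mod K" "\<lambda>w. K #>\<^bsub>F\<^esub> w" by (rule K.group_hom_Mod)
  define T where "T = (\<Union>x\<in>X. fp_incl H x ` carrier H)"
  have "finite ((\<lambda>w. K #>\<^bsub>F\<^esub> w) ` carrier F)"
  proof (rule q.finite_image_if_central_finite_index)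
    show "T \<subseteq> carrier F" by (auto simp: T_def F_def fp_incl_reduced)
    show "finite T" using H X by (simp add: T_def)
    show "generate F T = carrier F" unfolding T_def F_def by (rule generate_free_product) fact
    show "order H > 0" using H by (simp add: group.is_monoid monoid.order_gt_0_iff_finite)
    show "t [^]\<^bsub>F\<^esub> order H = \<one>\<^bsub>F\<^esub>" if "t \<in> T" for t
      using that fp_incl_pow_order[OF H(1)] by (auto simp: T_def F_def)
    show "subgroup M F" "finite (rcosets\<^bsub>F\<^esub> M)" using M by (simp_all add: F_def)
    fix g m assume gm: "g \<in> carrier F" "m \<in> M"
    then have "m \<in> carrier F" using subgroup.subset[OF M(1)] by (auto simp: F_def)
    moreover have "commutator F g m \<in> K"
      using gm comm C.commutator_mem M(3) by (auto simp: K_def verbal_kernel_def F_def)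
    ultimately show "K #>\<^bsub>F\<^esub> commutator F g m = \<one>\<^bsub>F Mod K\<^esub>"
      using K.rcos_eq_one_iff commutator_closed[OF K.is_group] gm by blast
  qed
  then show ?thesis by (simp add: verbal_product_eq carrier_FactGroup F_def K_def)
qed

section \<open>From \<open>n_word c\<close> to \<open>n_word (Suc c)\<close>, and finiteness of the
  verbal product\<close>

lemma commutator_word_value_n_word_mem:
  assumes "group G" "a \<in> {1..} \<rightarrow> carrier G" "g \<in> carrier G" "c \<ge> 1"
  shows "commutator G g (word_value G a (n_word c)) \<in> word_values G {n_word (Suc c)}"
proof -
  define b where "b = a(c + 2 := g)" \<comment> \<open>the variable \<open>x\<^bsub>c+2\<^esub>\<close> does not occur in \<open>n\<^sub>c\<close>\<close>
  have b: "b \<in> {1..} \<rightarrow> carrier G" using assms by (auto simp: b_def)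
  \<comment> \<open>For \<open>j\<close> between 1 and \<open>c\<close>, the word
    \<open>n_word j\<close> involves the variables with index at most \<open>j + 1\<close> only, and
    on these \<open>a\<close> and \<open>b\<close> agree.\<close>
  have b_eq: "b i = a i" if "i \<le> c + 1" for i using that by (simp add: b_def)
  have same: "j \<le> c \<Longrightarrow> word_value G b (n_word j) = word_value G a (n_word j)" for j
  proof (induction j rule: n_word.induct)
    case 1
    then show ?case by (simp add: word_value_def free_group_inf_def)
  next
    case 2
    then show ?case
      using word_value_n_word(1)[OF assms(1) b] word_value_n_word(1)[OF assms(1,2)] b_eq[of 1] b_eq[of 2]
      by (simp del: n_word.simps)
  next
    case (3 j)
    have "word_value G b (n_word (Suc (Suc j))) =
        commutator G (b (Suc j + 2)) (word_value G b (n_word (Suc j)))"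
      by (rule word_value_n_word(2)) (use assms b in auto)
    also have "\<dots> = commutator G (a (Suc j + 2)) (word_value G a (n_word (Suc j)))"
      using 3 b_eq[of "Suc j + 2"] by (simp del: n_word.simps)
    also have "\<dots> = word_value G a (n_word (Suc (Suc j)))"
      by (rule word_value_n_word(2)[symmetric]) (use assms in auto)
    finally show ?case .
  qed
  have "word_value G b (n_word (Suc c)) = commutator G g (word_value G a (n_word c))"
    using word_value_n_word(2)[OF assms(1) b assms(4)] same[OF order_refl] fun_upd_same[of a "c + 2" g, folded b_def]
    by (simp del: n_word.simps)
  then show ?thesis using word_valuesI[OF b, of "n_word (Suc c)"] by (simp del: n_word.simps)
qed

text \<open>\<open>verbal_subgroup G {n_word c}\<close> is the term \<open>\<gamma>\<^sub>c\<^sub>+\<^sub>1 G\<close> of the lower central series.\<close>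

lemma commutator_verbal_subgroup_n_word_mem:
  assumes "group G" "g \<in> carrier G" "c \<ge> 1" "m \<in> verbal_subgroup G {n_word c}"
  shows "commutator G g m \<in> verbal_subgroup G {n_word (Suc c)}"
proof -
  define V where "V = verbal_subgroup G {n_word (Suc c)}"
  define S where "S = word_values G {n_word c}"
  interpret V: normal V G
    unfolding V_def by (rule verbal_subgroup_normal[OF assms(1) n_word_singleton_carrier])
  interpret q: group_hom G "G Mod V" "\<lambda>w. V #>\<^bsub>G\<^esub> w" by (rule V.group_hom_Mod)
  have S: "S \<subseteq> carrier G"
    unfolding S_def by (rule word_values_carrier[OF assms(1) n_word_singleton_carrier])
  have m: "m \<in> generate G S" using assms(4) by (simp add: verbal_subgroup_eq S_def)
  have closed: "commutator G g x \<in> carrier G" if "x \<in> carrier G" for x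
    using commutator_closed[OF assms(1,2) that] .
  \<comment> \<open>Modulo \<open>V\<close>, \<open>g\<close> commutes with every value of
    \<open>n_word c\<close>, hence with the subgroup that these values generate.\<close>
  have "V #>\<^bsub>G\<^esub> commutator G g m = \<one>\<^bsub>G Mod V\<^esub>"
  proof (rule q.hom_commutator_generate[OF S _ assms(2) m])
    fix s assume s: "s \<in> S"
    then obtain a where "a \<in> {1..} \<rightarrow> carrier G" "s = word_value G a (n_word c)"
      by (auto simp: S_def word_values_def simp del: n_word.simps)
    then have "commutator G g s \<in> word_values G {n_word (Suc c)}"
      using commutator_word_value_n_word_mem[OF assms(1) _ assms(2,3)] by blast
    then have "commutator G g s \<in> V"
      unfolding V_def verbal_subgroup_eq by (rule generate.incl)
    then show "V #>\<^bsub>G\<^esub> commutator G g s = \<one>\<^bsub>G Mod V\<^esub>"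
      using V.rcos_eq_one_iff[OF closed] S s by blast
  qed
  moreover have "m \<in> carrier G" using V.generate_in_carrier[OF S m] .
  ultimately show ?thesis using V.rcos_eq_one_iff[OF closed] by (simp add: V_def)
qed

text \<open>Induction on \<open>k\<close>. The subgroup \<open>M\<close> of the step lemma is the
  whole cross-commutator subgroup at the start and the verbal kernel of \<open>n_word k\<close>
  afterwards; its finite index is the induction hypothesis.\<close>

theorem finite_verbal_product_n_word:
  assumes H: "group H" "finite (carrier H)" and X: "finite X" and "k \<ge> 1"
  shows "finite (carrier (verbal_product {n_word k} H X))"
  using assms(4)
proof (induction k rule: dec_induct)
  case base
  let ?F = "free_product H X"
  have F: "group ?F" using H by (intro group_free_product)
  have C: "subgroup (copies_commutator H X) ?F"
    using copies_commutator_normal[OF H(1)] normal_imp_subgroup by blast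
  show ?case
  proof (rule finite_verbal_product_step[OF H X _ C _ order_refl])
    show "{n_word 1} \<subseteq> carrier free_group_inf" by (rule n_word_singleton_carrier)
    show "finite (rcosets\<^bsub>?F\<^esub> copies_commutator H X)"
      using finite_free_product_Mod_copies_commutator[OF H X] by (simp add: FactGroup_def)
    fix g m assume gm: "g \<in> carrier ?F" "m \<in> copies_commutator H X"
    \<comment> \<open>The word \<open>n_word 1\<close> is the commutator of the second variable with
      the first, so the second takes the value \<open>g\<close> and the first the value
      \<open>m\<close>.\<close>
    define a where "a = (\<lambda>i::nat. if i = 2 then g else m)"
    have "m \<in> carrier ?F" using gm subgroup.subset[OF C] by auto
    then have a: "a \<in> {1..} \<rightarrow> carrier ?F" using gm by (auto simp: a_def)
    have "a 2 = g" "a 1 = m" by (simp_all add: a_def)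
    then have "commutator ?F g m \<in> word_values ?F {n_word 1}"
      using word_valuesI[OF a, of "n_word 1"] word_value_n_word(1)[OF F a]
      by (simp del: n_word.simps)
    then show "commutator ?F g m \<in> verbal_subgroup ?F {n_word 1}"
      unfolding verbal_subgroup_eq by (rule generate.incl)
  qed
next
  case (step k)
  show ?case
  proof (rule finite_verbal_product_step[OF H X])
    show "{n_word (Suc k)} \<subseteq> carrier free_group_inf" by (rule n_word_singleton_carrier)
    show "subgroup (verbal_kernel {n_word k} H X) (free_product H X)"
      using verbal_kernel_normal[OF H(1) n_word_singleton_carrier] by (rule normal_imp_subgroup)
    show "finite (rcosets\<^bsub>free_product H X\<^esub> verbal_kernel {n_word k} H X)"
      using step.IH by (simp add: verbal_product_eq FactGroup_def)
    show "verbal_kernel {n_word k} H X \<subseteq> copies_commutator H X" by (simp add: verbal_kernel_def)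
    fix g m assume "g \<in> carrier (free_product H X)" "m \<in> verbal_kernel {n_word k} H X"
    then show "commutator (free_product H X) g m \<in> verbal_subgroup (free_product H X) {n_word (Suc k)}"
      using commutator_verbal_subgroup_n_word_mem[OF group_free_product[OF H(1)] _ step.hyps(1)]
      by (auto simp: verbal_kernel_def)
  qed
qed

section \<open>Relabelling the copies along a partial injection\<close>

text \<open>Copies on which \<open>p\<close> is undefined are sent to the trivial subgroup. The
  index set \<open>UNIV\<close> keeps the target index set out of the definition.\<close>

definition fp_map :: "('h, 'b) monoid_scheme \<Rightarrow> ('x \<Rightarrow> 'y option) \<Rightarrow> ('x \<times> 'h) list \<Rightarrow> ('y \<times> 'h) list" where
  "fp_map H p = fp_eval (free_product H UNIV) (\<lambda>x. case p x of None \<Rightarrow> (\<lambda>h. []) | Some y \<Rightarrow> fp_incl H y)"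

definition partial_inj :: "'x set \<Rightarrow> 'y set \<Rightarrow> ('x \<Rightarrow> 'y option) \<Rightarrow> bool" where
  "partial_inj X Y p \<longleftrightarrow> (\<forall>x\<in>X. \<forall>y. p x = Some y \<longrightarrow> y \<in> Y) \<and>
    (\<forall>x\<in>X. \<forall>x'\<in>X. \<forall>y. p x = Some y \<longrightarrow> p x' = Some y \<longrightarrow> x = x')"

lemma partial_inj_restrict:
  assumes "inj_on f Z" "f ` Z \<subseteq> Y"
  shows "partial_inj X Y (\<lambda>x. if x \<in> Z then Some (f x) else None)"
  using assms by (auto simp: partial_inj_def dest: inj_onD split: if_splits)

text \<open>The product and the unit of a free product of copies do not mention the index set, so
  the target may be read with any \<open>Y\<close>.\<close>

lemma fp_map_eq:
  "fp_map H p = fp_eval (free_product H Y) (\<lambda>x. case p x of None \<Rightarrow> (\<lambda>h. []) | Some y \<Rightarrow> fp_incl H y)"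
  by (rule ext) (simp add: fp_map_def fp_eval_def)

lemma partial_inj_letter_hom:
  assumes "group H" "partial_inj X Y p" "x \<in> X"
  shows "(case p x of None \<Rightarrow> (\<lambda>h. []) | Some y \<Rightarrow> fp_incl H y) \<in> hom H (free_product H Y)"
proof (cases "p x")
  case None
  then show ?thesis by (auto intro!: homI)
next
  case (Some y)
  then have "y \<in> Y" using assms by (auto simp: partial_inj_def)
  then show ?thesis using fp_incl_hom[OF assms(1)] Some by simp
qed

lemma fp_map_hom:
  assumes "group H" "partial_inj X Y p"
  shows "fp_map H p \<in> hom (free_product H X) (free_product H Y)"
  unfolding fp_map_eq[where Y = Y]
  by (rule fp_eval_hom[OF assms(1) group_free_product[OF assms(1)] partial_inj_letter_hom[OF assms]])

lemma fp_map_group_hom: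
  assumes "group H" "partial_inj X Y p"
  shows "group_hom (free_product H X) (free_product H Y) (fp_map H p)"
  using fp_map_hom[OF assms] by (simp add: group_free_product[OF assms(1)] group_hom_def group_hom_axioms_def)

lemma fp_map_incl:
  assumes "group H" "partial_inj X Y p" "x \<in> X" "h \<in> carrier H"
  shows "fp_map H p (fp_incl H x h) = (case p x of None \<Rightarrow> [] | Some y \<Rightarrow> fp_incl H y h)"
proof -
  have "fp_map H p (fp_incl H x h) = (case p x of None \<Rightarrow> (\<lambda>h. []) | Some y \<Rightarrow> fp_incl H y) h"
    unfolding fp_map_eq[where Y = Y]
    by (rule fp_eval_incl[OF assms(1) group_free_product[OF assms(1)]
          partial_inj_letter_hom[OF assms(1,2)] assms(3,4)])
  then show ?thesis by (simp split: option.splits)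
qed

lemma fp_map_closed:
  assumes "group H" "partial_inj X Y p" "w \<in> reduced_words H X"
  shows "fp_map H p w \<in> reduced_words H Y"
  using hom_in_carrier[OF fp_map_hom[OF assms(1,2)], of w] assms(3) by simp

text \<open>If one of two copies is killed, their commutators become trivial; otherwise injectivity
  keeps the copies distinct and a cross-commutator goes to a cross-commutator. The preimage of the
  target subgroup is normal, so it contains the normal closure.\<close>

lemma fp_map_copies_commutator:
  assumes "group H" "partial_inj X Y p"
  shows "fp_map H p ` copies_commutator H X \<subseteq> copies_commutator H Y"
proof -
  interpret f: group_hom "free_product H X" "free_product H Y" "fp_map H p"
    using assms by (rule fp_map_group_hom)
  interpret C: normal "copies_commutator H Y" "free_product H Y"
    by (rule copies_commutator_normal) fact
  let ?N = "{w \<in> carrier (free_product H X). fp_map H p w \<in> copies_commutator H Y}"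
  have "copies_commutator H X \<subseteq> ?N"
    unfolding copies_commutator_def[of H X]
  proof (rule normal_closure_minimal, rule normal_vimage[OF f.group_hom_axioms C.normal_axioms], rule subsetI)
    fix c
    assume "c \<in> {commutator (free_product H X) (fp_incl H x h) (fp_incl H y k) | x y h k.
      x \<in> X \<and> y \<in> X \<and> x \<noteq> y \<and> h \<in> carrier H \<and> k \<in> carrier H}"
    then obtain x y h k where c: "c = commutator (free_product H X) (fp_incl H x h) (fp_incl H y k)"
      and xy: "x \<in> X" "y \<in> X" "x \<noteq> y" "h \<in> carrier H" "k \<in> carrier H" by blast
    define u where "u = fp_map H p (fp_incl H x h)"
    define v where "v = fp_map H p (fp_incl H y k)"
    have incl: "fp_incl H x h \<in> carrier (free_product H X)" "fp_incl H y k \<in> carrier (free_product H X)"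
      using xy by (simp_all add: fp_incl_reduced)
    then have uv: "u \<in> carrier (free_product H Y)" "v \<in> carrier (free_product H Y)"
      unfolding u_def v_def by (blast intro: f.hom_closed)+
    have u: "u = (case p x of None \<Rightarrow> \<one>\<^bsub>free_product H Y\<^esub> | Some z \<Rightarrow> fp_incl H z h)"
      and v: "v = (case p y of None \<Rightarrow> \<one>\<^bsub>free_product H Y\<^esub> | Some z \<Rightarrow> fp_incl H z k)"
      unfolding u_def v_def one_free_product using fp_map_incl[OF assms] xy by simp_all
    have "commutator (free_product H Y) u v \<in> copies_commutator H Y"
    proof (cases "p x = None \<or> p y = None")
      case True
      then have "commutator (free_product H Y) u v = \<one>\<^bsub>free_product H Y\<^esub>"
        using u v uv commutator_one[OF f.H.is_group] by (auto simp del: one_free_product)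
      then show ?thesis using C.one_closed by simp
    next
      case False
      then obtain z z' where z: "p x = Some z" "p y = Some z'" by auto
      then have "z \<in> Y" "z' \<in> Y" "z \<noteq> z'" using assms(2) xy unfolding partial_inj_def by blast+
      then show ?thesis using u v z xy commutator_fp_incl_mem by simp
    qed
    then show "c \<in> ?N"
      using incl f.hom_commutator[OF incl] commutator_closed[OF f.G.is_group incl]
      by (simp add: c u_def v_def)
  qed
  then show ?thesis by blast
qed

text \<open>This makes relabelling descend to verbal products. Every homomorphism preserves verbal
  subgroups, and partial injections also preserve cross-commutators.\<close>

lemma fp_map_verbal_kernel:
  assumes "group H" "partial_inj X Y p" "W \<subseteq> carrier free_group_inf"
  shows "fp_map H p ` verbal_kernel W H X \<subseteq> verbal_kernel W H Y"
  using fp_map_copies_commutator[OF assms(1,2)]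
    group_hom.hom_verbal_subgroup[OF fp_map_group_hom[OF assms(1,2)] assms(3)]
  unfolding verbal_kernel_def by blast

text \<open>The index maps need to match only on copies occurring in \<open>w\<close>. This allows a
  left inverse and an equivariance that hold only locally.\<close>

lemma fp_map_eqI:
  assumes H: "group H" and p: "partial_inj X Y p" and q: "partial_inj Y Z q" and r: "partial_inj X Z r"
    and w: "w \<in> reduced_words H X"
    and eq: "\<And>x h. (x, h) \<in> set w \<Longrightarrow> Option.bind (p x) q = r x"
  shows "fp_map H q (fp_map H p w) = fp_map H r w"
proof -
  have hom: "fp_map H q \<circ> fp_map H p \<in> hom (free_product H X) (free_product H Z)"
    using fp_map_hom[OF H p] fp_map_hom[OF H q] by (rule hom_compose)
  interpret q: group_hom "free_product H Y" "free_product H Z" "fp_map H q"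
    using H q by (rule fp_map_group_hom)
  have "(fp_map H q \<circ> fp_map H p) w = fp_map H r w"
  proof (rule free_product_hom_eqI[OF H hom fp_map_hom[OF H r] group_free_product[OF H] w])
    fix x h assume xh: "(x, h) \<in> set w"
    then have x: "x \<in> X" "h \<in> carrier H" using reduced_words_letters[OF w] by auto
    show "(fp_map H q \<circ> fp_map H p) (fp_incl H x h) = fp_map H r (fp_incl H x h)"
    proof (cases "p x")
      case None
      then show ?thesis
        using eq[OF xh] x fp_map_incl[OF H p] fp_map_incl[OF H r] q.hom_one by simp
    next
      case (Some y)
      then have "y \<in> Y" using p x unfolding partial_inj_def by blast
      then show ?thesis
        using Some eq[OF xh] x fp_map_incl[OF H p] fp_map_incl[OF H r] fp_map_incl[OF H q] by simp
    qed
  qed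
  then show ?thesis by simp
qed

text \<open>Injectivity keeps neighbouring letters in different copies, so nothing merges. This
  links \<open>fp_map\<close> to the plain relabelling used in
  \<open>induced_action\<close>.\<close>

lemma fp_map_Some_eq_map:
  assumes "w \<in> reduced_words H X" "inj_on f X"
  shows "fp_map H (\<lambda>x. Some (f x)) w = map (\<lambda>(x, h). (f x, h)) w"
  using assms(1)
proof (induction w)
  case Nil
  show ?case by (simp add: fp_map_def fp_eval_def)
next
  case (Cons p w)
  obtain x h where p: "p = (x, h)" by (cases p)
  note * = reduced_words_ConsD[OF Cons.prems[unfolded p]]
  have "fp_map H (\<lambda>x. Some (f x)) (p # w) = fp_cons H (f x, h) (map (\<lambda>(x, h). (f x, h)) w)"
    using Cons.IH *(3,4) p by (simp add: fp_map_def fp_eval_def fp_incl_def)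
  also have "\<dots> = map (\<lambda>(x, h). (f x, h)) (p # w)"
  proof (cases w)
    case Nil
    then show ?thesis using * p by simp
  next
    case (Cons r v)
    then have "fst r \<in> X" "fst r \<noteq> x"
      using Cons.prems p by (auto simp: reduced_words_def)
    then have "f (fst r) \<noteq> f x" using *(1) assms(2) by (auto dest: inj_onD)
    then show ?thesis using * p Cons by (cases r) auto
  qed
  finally show ?case .
qed

lemma fp_map_Some_id: "w \<in> reduced_words H X \<Longrightarrow> fp_map H Some w = w"
  using fp_map_Some_eq_map[of w H X "\<lambda>x. x"] by simp

text \<open>The image of a coset of \<open>N\<close> lies in one coset of \<open>M\<close>, and
  multiplying by \<open>M\<close> fills that coset. The left-hand side thus describes the induced
  map on quotients without choosing representatives.\<close>

lemma (in group_hom) set_mult_image_rcos: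
  assumes "N \<lhd> G" "M \<lhd> H" "h ` N \<subseteq> M" "w \<in> carrier G"
  shows "M <#>\<^bsub>H\<^esub> h ` (N #>\<^bsub>G\<^esub> w) = M #>\<^bsub>H\<^esub> h w"
proof -
  interpret N: normal N G by fact
  interpret M: normal M H by fact
  show ?thesis
  proof
    show "M <#>\<^bsub>H\<^esub> h ` (N #>\<^bsub>G\<^esub> w) \<subseteq> M #>\<^bsub>H\<^esub> h w"
    proof
      fix y assume "y \<in> M <#>\<^bsub>H\<^esub> h ` (N #>\<^bsub>G\<^esub> w)"
      then obtain m n where mn: "m \<in> M" "n \<in> N" "y = m \<otimes>\<^bsub>H\<^esub> h (n \<otimes>\<^bsub>G\<^esub> w)"
        by (auto simp: set_mult_def r_coset_def)
      have "h n \<in> M" using mn assms by blast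
      moreover have "y = (m \<otimes>\<^bsub>H\<^esub> h n) \<otimes>\<^bsub>H\<^esub> h w" using mn assms N.subset M.subset by (simp add: H.m_assoc subset_iff)
      ultimately show "y \<in> M #>\<^bsub>H\<^esub> h w" using mn by (auto simp: r_coset_def)
    qed
    show "M #>\<^bsub>H\<^esub> h w \<subseteq> M <#>\<^bsub>H\<^esub> h ` (N #>\<^bsub>G\<^esub> w)"
    proof
      fix y assume "y \<in> M #>\<^bsub>H\<^esub> h w"
      then obtain m where "m \<in> M" "y = m \<otimes>\<^bsub>H\<^esub> h w" by (auto simp: r_coset_def)
      then show "y \<in> M <#>\<^bsub>H\<^esub> h ` (N #>\<^bsub>G\<^esub> w)"
        using G.rcos_self[OF assms(4) N.subgroup_axioms] unfolding set_mult_def by blast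
    qed
  qed
qed

section \<open>The verbal wreath product\<close>

lemma group_semidirect_product:
  assumes N: "group N" and G: "group G"
    and hom: "\<And>g. g \<in> carrier G \<Longrightarrow> \<theta> g \<in> hom N N"
    and one: "\<And>n. n \<in> carrier N \<Longrightarrow> \<theta> \<one>\<^bsub>G\<^esub> n = n"
    and mult: "\<And>g h n. g \<in> carrier G \<Longrightarrow> h \<in> carrier G \<Longrightarrow> n \<in> carrier N \<Longrightarrow>
      \<theta> (g \<otimes>\<^bsub>G\<^esub> h) n = \<theta> g (\<theta> h n)"
  shows "group (semidirect_product N G \<theta>)"
proof -
  interpret N: group N by fact
  interpret G: group G by fact
  have closed: "\<theta> g n \<in> carrier N" if "g \<in> carrier G" "n \<in> carrier N" for g n
    using hom_in_carrier[OF hom] that by blast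
  have distrib: "\<theta> g (n \<otimes>\<^bsub>N\<^esub> m) = \<theta> g n \<otimes>\<^bsub>N\<^esub> \<theta> g m"
    if "g \<in> carrier G" "n \<in> carrier N" "m \<in> carrier N" for g n m
    using hom_mult[OF hom] that by blast
  show ?thesis
  proof (rule groupI)
    fix x assume "x \<in> carrier (semidirect_product N G \<theta>)"
    then obtain n g where x: "x = (n, g)" "n \<in> carrier N" "g \<in> carrier G"
      by (auto simp: semidirect_product_def)
    have "\<theta> (inv\<^bsub>G\<^esub> g) (inv\<^bsub>N\<^esub> n) \<otimes>\<^bsub>N\<^esub> \<theta> (inv\<^bsub>G\<^esub> g) n = \<theta> (inv\<^bsub>G\<^esub> g) \<one>\<^bsub>N\<^esub>"
      using x distrib[of "inv\<^bsub>G\<^esub> g" "inv\<^bsub>N\<^esub> n" n] by simp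
    also have "\<dots> = \<one>\<^bsub>N\<^esub>" using hom_one[OF hom N N] x by simp
    finally show "\<exists>y\<in>carrier (semidirect_product N G \<theta>).
        y \<otimes>\<^bsub>semidirect_product N G \<theta>\<^esub> x = \<one>\<^bsub>semidirect_product N G \<theta>\<^esub>"
      using x closed
      by (intro bexI[of _ "(\<theta> (inv\<^bsub>G\<^esub> g) (inv\<^bsub>N\<^esub> n), inv\<^bsub>G\<^esub> g)"])
        (simp_all add: semidirect_product_def)
  qed (auto simp: semidirect_product_def closed distrib one mult N.m_assoc G.m_assoc)
qed

section \<open>The induced action on cosets and the group structure\<close>

context
  fixes H :: "('h, 'b) monoid_scheme" and \<Gamma> :: "('g, 'c) monoid_scheme"
    and X :: "'x set" and \<alpha> :: "'g \<Rightarrow> 'x \<Rightarrow> 'x" and W :: "(nat \<times> int) list set"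
  assumes H: "group H" and \<alpha>: "group_action \<Gamma> X \<alpha>" and W: "W \<subseteq> carrier free_group_inf"
begin

lemma partial_inj_action:
  assumes "g \<in> carrier \<Gamma>"
  shows "partial_inj X X (\<lambda>x. Some (\<alpha> g x))"
proof -
  have "\<alpha> g ` X = X" "inj_on (\<alpha> g) X"
    using group_action.surj_prop[OF \<alpha> assms] group_action.inj_prop[OF \<alpha> assms] by simp_all
  then show ?thesis unfolding partial_inj_def inj_on_def by auto
qed

lemma fp_map_action_mult:
  assumes "g \<in> carrier \<Gamma>" "h \<in> carrier \<Gamma>" "w \<in> reduced_words H X"
  shows "fp_map H (\<lambda>x. Some (\<alpha> g x)) (fp_map H (\<lambda>x. Some (\<alpha> h x)) w) =
    fp_map H (\<lambda>x. Some (\<alpha> (g \<otimes>\<^bsub>\<Gamma>\<^esub> h) x)) w"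
proof (rule fp_map_eqI[OF H partial_inj_action partial_inj_action partial_inj_action])
  interpret group_action \<Gamma> X \<alpha> by (rule \<alpha>)
  interpret group \<Gamma> using group_hom group_hom.axioms(1) by blast
  show "g \<otimes>\<^bsub>\<Gamma>\<^esub> h \<in> carrier \<Gamma>" using assms by simp
  fix x k assume "(x, k) \<in> set w"
  then have "x \<in> X" using reduced_words_letters[OF assms(3)] by auto
  then show "Option.bind (Some (\<alpha> h x)) (\<lambda>x. Some (\<alpha> g x)) = Some (\<alpha> (g \<otimes>\<^bsub>\<Gamma>\<^esub> h) x)"
    using composition_rule assms by simp
qed (use assms in auto)

lemma fp_map_action_one:
  assumes "w \<in> reduced_words H X"
  shows "fp_map H (\<lambda>x. Some (\<alpha> \<one>\<^bsub>\<Gamma>\<^esub> x)) w = w"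
proof -
  interpret group_action \<Gamma> X \<alpha> by (rule \<alpha>)
  interpret group \<Gamma> using group_hom group_hom.axioms(1) by blast
  have id: "\<alpha> \<one>\<^bsub>\<Gamma>\<^esub> x = x" if "x \<in> X" for x using id_eq_one[symmetric] that by simp
  have "fp_map H (\<lambda>x. Some (\<alpha> \<one>\<^bsub>\<Gamma>\<^esub> x)) w = map (\<lambda>(x, h). (\<alpha> \<one>\<^bsub>\<Gamma>\<^esub> x, h)) w"
    using assms inj_prop by (intro fp_map_Some_eq_map) auto
  also have "\<dots> = w"
    using id reduced_words_letters[OF assms] by (intro map_idI) auto
  finally show ?thesis .
qed

text \<open>The image of a coset is a full coset because relabelling by \<open>g\<close> maps the
  kernel onto itself: it maps it into itself, and so does relabelling by the inverse of
  \<open>g\<close>.\<close>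

lemma induced_action_rcos:
  assumes g: "g \<in> carrier \<Gamma>" and w: "w \<in> reduced_words H X"
  shows "induced_action \<alpha> g (verbal_kernel W H X #>\<^bsub>free_product H X\<^esub> w) =
    verbal_kernel W H X #>\<^bsub>free_product H X\<^esub> fp_map H (\<lambda>x. Some (\<alpha> g x)) w"
proof -
  define F where "F = free_product H X"
  define K where "K = verbal_kernel W H X"
  define s where "s = (\<lambda>g. fp_map H (\<lambda>x. Some (\<alpha> g x)))"
  interpret A: group_action \<Gamma> X \<alpha> by (rule \<alpha>)
  interpret \<Gamma>: group \<Gamma> using A.group_hom group_hom.axioms(1) by blast
  interpret K: normal K F unfolding K_def F_def by (rule verbal_kernel_normal[OF H W])
  have hom: "group_hom F F (s g)" if "g \<in> carrier \<Gamma>" for g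
    unfolding F_def s_def by (rule fp_map_group_hom[OF H partial_inj_action[OF that]])
  have sK: "s g ` K \<subseteq> K" if "g \<in> carrier \<Gamma>" for g
    unfolding s_def K_def by (rule fp_map_verbal_kernel[OF H partial_inj_action[OF that] W])
  have KF: "x \<in> reduced_words H X" if "x \<in> K" for x using that K.subset by (auto simp: F_def)
  have "K \<subseteq> s g ` K"
  proof
    fix x assume x: "x \<in> K"
    have "s g (s (inv\<^bsub>\<Gamma>\<^esub> g) x) = x"
      using fp_map_action_mult[OF g \<Gamma>.inv_closed[OF g] KF[OF x]] fp_map_action_one[OF KF[OF x]]
      unfolding s_def \<Gamma>.r_inv[OF g] by (rule trans)
    moreover have "s (inv\<^bsub>\<Gamma>\<^esub> g) x \<in> K" using sK[OF \<Gamma>.inv_closed[OF g]] x by blast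
    ultimately show "x \<in> s g ` K" by (intro rev_image_eqI) auto
  qed
  then have "s g ` K = K" using sK[OF g] by blast
  have "K #>\<^bsub>F\<^esub> w \<subseteq> reduced_words H X"
    using K.r_coset_subset_G[OF K.subset, of w] w by (simp add: F_def)
  then have "induced_action \<alpha> g (K #>\<^bsub>F\<^esub> w) = s g ` (K #>\<^bsub>F\<^esub> w)"
    unfolding induced_action_def s_def
    by (intro image_cong refl fp_map_Some_eq_map[OF _ A.inj_prop[OF g], symmetric]) blast
  also have "s g ` (K #>\<^bsub>F\<^esub> w) = (\<lambda>x. s g x \<otimes>\<^bsub>F\<^esub> s g w) ` K"
    unfolding r_coset_def image_UN image_insert image_empty UNION_singleton_eq_range image_image
  proof (rule image_cong[OF refl])
    fix x assume "x \<in> K"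
    then show "s g (x \<otimes>\<^bsub>F\<^esub> w) = s g x \<otimes>\<^bsub>F\<^esub> s g w"
      using group_hom.hom_mult[OF hom[OF g], of x w] K.subset w by (auto simp: F_def)
  qed
  also have "\<dots> = (s g ` K) #>\<^bsub>F\<^esub> s g w" by (auto simp: r_coset_def)
  finally show ?thesis using \<open>s g ` K = K\<close> by (simp add: K_def F_def s_def)
qed

lemma group_verbal_wreath_product: "group (verbal_wreath_product W H \<Gamma> X \<alpha>)"
proof -
  define F where "F = free_product H X"
  define K where "K = verbal_kernel W H X"
  interpret A: group_action \<Gamma> X \<alpha> by (rule \<alpha>)
  interpret \<Gamma>: group \<Gamma> using A.group_hom group_hom.axioms(1) by blast
  interpret K: normal K F unfolding K_def F_def by (rule verbal_kernel_normal[OF H W])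
  have act: "induced_action \<alpha> g (K #>\<^bsub>F\<^esub> w) = K #>\<^bsub>F\<^esub> fp_map H (\<lambda>x. Some (\<alpha> g x)) w"
    "fp_map H (\<lambda>x. Some (\<alpha> g x)) w \<in> carrier F"
    if "g \<in> carrier \<Gamma>" "w \<in> carrier F" for g w
    using that induced_action_rcos fp_map_closed[OF H partial_inj_action]
    by (simp_all add: F_def K_def)
  have "group (semidirect_product (F Mod K) \<Gamma> (induced_action \<alpha>))"
  proof (rule group_semidirect_product[OF K.factorgroup_is_group \<Gamma>.is_group])
    fix g assume g: "g \<in> carrier \<Gamma>"
    interpret s: group_hom F F "fp_map H (\<lambda>x. Some (\<alpha> g x))"
      unfolding F_def by (rule fp_map_group_hom[OF H partial_inj_action[OF g]])
    show "induced_action \<alpha> g \<in> hom (F Mod K) (F Mod K)"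
      by (rule homI) (auto simp: carrier_FactGroup act g K.rcos_sum)
  next
    fix C assume "C \<in> carrier (F Mod K)"
    then obtain w where w: "w \<in> carrier F" "C = K #>\<^bsub>F\<^esub> w" by (auto simp: carrier_FactGroup)
    show "induced_action \<alpha> \<one>\<^bsub>\<Gamma>\<^esub> C = C"
      using w act(1)[of "\<one>\<^bsub>\<Gamma>\<^esub>" w] fp_map_action_one[of w] by (simp add: F_def)
    fix g h assume gh: "g \<in> carrier \<Gamma>" "h \<in> carrier \<Gamma>"
    show "induced_action \<alpha> (g \<otimes>\<^bsub>\<Gamma>\<^esub> h) C = induced_action \<alpha> g (induced_action \<alpha> h C)"
      using w gh act fp_map_action_mult[OF gh, of w] by (simp add: F_def)
  qed
  then show ?thesis by (simp add: verbal_wreath_product_def verbal_product_eq F_def K_def)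
qed

end

section \<open>Finite models and the local embedding\<close>

lemma finite_group_nat_copy:
  assumes "group G" "finite (carrier G)"
  obtains Q :: "nat monoid" and f where
    "group Q" "finite (carrier Q)" "f \<in> hom G Q" "inj_on f (carrier G)"
proof -
  interpret group G by fact
  obtain f :: "'a \<Rightarrow> nat" where f: "inj_on f (carrier G)"
    using finite_imp_inj_to_nat_seg[OF assms(2)] by blast
  \<comment> \<open>The product is transported along \<open>f\<close>. The carrier
    \<open>UNIV\<close> and the unit 0 are provisional; they are replaced by the image of
    \<open>f\<close> and the image of the unit of \<open>G\<close>.\<close>
  define M where "M = \<lparr>carrier = (UNIV :: nat set),
    monoid.mult = (\<lambda>a b. f (inv_into (carrier G) f a \<otimes>\<^bsub>G\<^esub> inv_into (carrier G) f b)), one = 0\<rparr>"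
  have hom: "f \<in> hom G M" by (rule homI) (simp_all add: M_def f)
  show ?thesis
  proof (rule that)
    show "group (M\<lparr>carrier := f ` carrier G, one := f \<one>\<^bsub>G\<^esub>\<rparr>)" using hom by (rule hom_imp_img_group)
    show "f \<in> hom G (M\<lparr>carrier := f ` carrier G, one := f \<one>\<^bsub>G\<^esub>\<rparr>)"
      using hom by (auto simp: hom_def)
  qed (use assms f in simp_all)
qed

text \<open>The definition asks for finite models carried by natural numbers. Passing to an
  isomorphic copy admits finite groups of any type, such as one built from cosets of words.\<close>

lemma LEF_groupI:
  assumes "group G"
    and "\<And>A. finite A \<Longrightarrow> A \<subseteq> carrier G \<Longrightarrow>
      \<exists>(Q :: 'q monoid) \<phi>. group Q \<and> finite (carrier Q) \<and> \<phi> \<in> A \<rightarrow> carrier Q \<and> inj_on \<phi> A \<and>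
        (\<forall>g\<in>A. \<forall>h\<in>A. g \<otimes>\<^bsub>G\<^esub> h \<in> A \<longrightarrow> \<phi> (g \<otimes>\<^bsub>G\<^esub> h) = \<phi> g \<otimes>\<^bsub>Q\<^esub> \<phi> h)"
  shows "LEF_group G"
  unfolding LEF_group_def
proof (intro conjI allI impI assms(1))
  fix A assume A: "finite A \<and> A \<subseteq> carrier G"
  obtain Q :: "'q monoid" and \<phi> where Q: "group Q" "finite (carrier Q)"
    and \<phi>: "\<phi> \<in> A \<rightarrow> carrier Q" "inj_on \<phi> A"
      "\<forall>g\<in>A. \<forall>h\<in>A. g \<otimes>\<^bsub>G\<^esub> h \<in> A \<longrightarrow> \<phi> (g \<otimes>\<^bsub>G\<^esub> h) = \<phi> g \<otimes>\<^bsub>Q\<^esub> \<phi> h"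
    using assms(2)[OF A[THEN conjunct1] A[THEN conjunct2]] by (elim exE conjE) (rule that)
  obtain R :: "nat monoid" and f where R: "group R" "finite (carrier R)"
    and f: "f \<in> hom Q R" "inj_on f (carrier Q)"
    using finite_group_nat_copy[OF Q] .
  have \<phi>Q: "\<phi> a \<in> carrier Q" if "a \<in> A" for a using \<phi>(1) that by blast
  have "f \<circ> \<phi> \<in> A \<rightarrow> carrier R" using hom_in_carrier[OF f(1) \<phi>Q] by simp
  moreover have "inj_on (f \<circ> \<phi>) A"
    by (rule comp_inj_on[OF \<phi>(2) inj_on_subset[OF f(2)]]) (use \<phi>Q in blast)
  moreover have "(f \<circ> \<phi>) (g \<otimes>\<^bsub>G\<^esub> h) = (f \<circ> \<phi>) g \<otimes>\<^bsub>R\<^esub> (f \<circ> \<phi>) h"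
    if "g \<in> A" "h \<in> A" "g \<otimes>\<^bsub>G\<^esub> h \<in> A" for g h
    using that \<phi>(3) hom_mult[OF f(1) \<phi>Q \<phi>Q] by simp
  ultimately show "\<exists>(Q :: nat monoid) \<phi>. group Q \<and> finite (carrier Q) \<and>
        \<phi> \<in> A \<rightarrow> carrier Q \<and> inj_on \<phi> A \<and>
        (\<forall>g\<in>A. \<forall>h\<in>A. g \<otimes>\<^bsub>G\<^esub> h \<in> A \<longrightarrow> \<phi> (g \<otimes>\<^bsub>G\<^esub> h) = \<phi> g \<otimes>\<^bsub>Q\<^esub> \<phi> h)"
    using R by (intro exI[of _ R] exI[of _ "f \<circ> \<phi>"] conjI ballI impI) simp_all
qed

theorem theorem6p27:
  fixes \<Gamma> :: "('g, 'c) monoid_scheme" and H :: "('h, 'b) monoid_scheme"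
    and X :: "'x set" and \<alpha> :: "'g \<Rightarrow> 'x \<Rightarrow> 'x" and k :: nat
  assumes "k \<ge> 1"
    and "LEF_group \<Gamma>"
    and "LEF_action \<Gamma> X \<alpha>"
    and "group H" and "finite (carrier H)"
  shows "LEF_group (verbal_wreath_product {n_word k} H \<Gamma> X \<alpha>)"
proof (rule LEF_groupI)
  let ?W = "{n_word k}"
  have W: "?W \<subseteq> carrier free_group_inf" by (rule n_word_singleton_carrier)
  note H = \<open>group H\<close>
  have \<alpha>: "group_action \<Gamma> X \<alpha>" using assms(3) by (simp add: LEF_action_def)
  interpret A: group_action \<Gamma> X \<alpha> by (rule \<alpha>)
  interpret \<Gamma>: group \<Gamma> using A.group_hom group_hom.axioms(1) by blast
  show "group (verbal_wreath_product ?W H \<Gamma> X \<alpha>)"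
    by (rule group_verbal_wreath_product[OF H \<alpha> W])
  define F where "F = free_product H X"
  define K where "K = verbal_kernel ?W H X"
  interpret K: normal K F unfolding K_def F_def by (rule verbal_kernel_normal[OF H W])
  define s where "s = (\<lambda>g. fp_map H (\<lambda>x. Some (\<alpha> g x)))"
  fix A assume "finite A" and A: "A \<subseteq> carrier (verbal_wreath_product ?W H \<Gamma> X \<alpha>)"
  have A': "C \<in> carrier (verbal_product ?W H X)" "g \<in> carrier \<Gamma>" if "(C, g) \<in> A" for C g
    using that A by (auto simp: verbal_wreath_product_def semidirect_product_def)
  have "\<exists>w. w \<in> carrier F \<and> C = K #>\<^bsub>F\<^esub> w" if "C \<in> fst ` A" for C
  proof -
    have "C \<in> carrier (verbal_product ?W H X)" using that A'(1) by auto
    then show ?thesis by (auto simp: verbal_product_eq carrier_FactGroup F_def K_def)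
  qed
  then obtain r where r: "r C \<in> carrier F" "C = K #>\<^bsub>F\<^esub> r C" if "C \<in> fst ` A" for C
    by metis
  define E where "E = snd ` A"
  \<comment> \<open>\<open>Z\<^sub>0\<close> holds the indices occurring in the representatives
    \<open>r C\<close>. Adding the translates under \<open>E\<close> ensures that \<alpha>
    \<open>g x\<close> stays in \<open>Z\<close> for \<open>x\<close> in \<open>Z\<^sub>0\<close>,
    as the equivariance of \<pi> demands.\<close>
  define Z\<^sub>0 where "Z\<^sub>0 = (\<Union>C \<in> fst ` A. fst ` set (r C))"
  define Z where "Z = Z\<^sub>0 \<union> (\<Union>g\<in>E. \<alpha> g ` Z\<^sub>0)"
  have E: "finite E" "E \<subseteq> carrier \<Gamma>" using \<open>finite A\<close> A' by (auto simp: E_def)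
  have rZ: "x \<in> Z\<^sub>0" if "C \<in> fst ` A" "(x, h) \<in> set (r C)" for C x h
    using that by (force simp: Z\<^sub>0_def)
  have "Z\<^sub>0 \<subseteq> X" using r(1) reduced_words_letters by (fastforce simp: Z\<^sub>0_def F_def)
  moreover have "\<alpha> g x \<in> X" if "g \<in> E" "x \<in> X" for g x
    using A.element_image[OF _ that(2) refl] that(1) E(2) by blast
  moreover have "finite Z\<^sub>0" using \<open>finite A\<close> by (simp add: Z\<^sub>0_def)
  ultimately have Z: "finite Z" "Z \<subseteq> X" using E(1) by (auto simp: Z_def)
  obtain Q :: "nat monoid" and Y :: "nat set" and \<beta> \<rho> \<pi> where
    Q: "group Q" "finite (carrier Q)" and Y: "finite Y" and \<beta>: "group_action Q Y \<beta>"
    and \<rho>: "\<rho> \<in> carrier \<Gamma> \<rightarrow> carrier Q" and \<pi>: "\<pi> \<in> Z \<rightarrow> Y" "inj_on \<pi> Z"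
    and \<rho>_mult: "\<forall>g\<in>E. \<forall>h\<in>E. g \<otimes>\<^bsub>\<Gamma>\<^esub> h \<in> E \<longrightarrow> \<rho> (g \<otimes>\<^bsub>\<Gamma>\<^esub> h) = \<rho> g \<otimes>\<^bsub>Q\<^esub> \<rho> h"
    and \<pi>_act: "\<forall>g\<in>E. \<forall>x\<in>Z. \<alpha> g x \<in> Z \<longrightarrow> \<pi> (\<alpha> g x) = \<beta> (\<rho> g) (\<pi> x)"
    using assms(3)[unfolded LEF_action_def, THEN conjunct2, THEN spec, THEN spec, THEN mp,
        OF conjI[OF E(1) conjI[OF E(2) conjI[OF Z]]]]
    by (elim exE conjE) (rule that)
  obtain Q' :: "nat monoid" and \<phi> where
    Q': "group Q'" "finite (carrier Q')" and \<phi>: "\<phi> \<in> E \<rightarrow> carrier Q'" "inj_on \<phi> E"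
    and \<phi>_mult: "\<forall>g\<in>E. \<forall>h\<in>E. g \<otimes>\<^bsub>\<Gamma>\<^esub> h \<in> E \<longrightarrow> \<phi> (g \<otimes>\<^bsub>\<Gamma>\<^esub> h) = \<phi> g \<otimes>\<^bsub>Q'\<^esub> \<phi> h"
    using assms(2)[unfolded LEF_group_def, THEN conjunct2, THEN spec, THEN mp, OF conjI[OF E]]
    by (elim exE conjE) (rule that)
  define F' where "F' = free_product H Y"
  define K' where "K' = verbal_kernel ?W H Y"
  interpret K': normal K' F' unfolding K'_def F'_def by (rule verbal_kernel_normal[OF H W])
  define s' where "s' = (\<lambda>g :: nat \<times> nat. fp_map H (\<lambda>y. Some ((\<beta> \<circ> fst) g y)))"
  \<comment> \<open>The factor \<open>Q'\<close> acts trivially on \<open>Y\<close>; it is there to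
    separate the elements of \<open>E\<close>.\<close>
  have \<beta>': "group_action (Q \<times>\<times> Q') Y (\<beta> \<circ> fst)"
    using \<beta> hom_of_fst[OF Q'(1), of \<beta> Q "BijGroup Y"] DirProd_group[OF Q(1) Q'(1)]
    by (simp add: group_action_def group_hom_def group_hom_axioms_def)
  define T where "T = verbal_wreath_product ?W H (Q \<times>\<times> Q') Y (\<beta> \<circ> fst)"
  define p where "p = (\<lambda>x. if x \<in> Z then Some (\<pi> x) else None)"
  define p' where "p' = (\<lambda>y. if y \<in> \<pi> ` Z then Some (inv_into Z \<pi> y) else None)"
  have p: "partial_inj X Y p" 
    unfolding p_def by (rule partial_inj_restrict[OF \<pi>(2)]) (use \<pi>(1) in blast)
  have p': "partial_inj Y X p'"
    unfolding p'_def
    by (rule partial_inj_restrict) (use Z(2) in \<open>auto simp: inv_into_f_f[OF \<pi>(2)] intro: inj_on_inv_into\<close>)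
  interpret P: group_hom F F' "fp_map H p"
    unfolding F_def F'_def by (rule fp_map_group_hom[OF H p])
  interpret P': group_hom F' F "fp_map H p'"
    unfolding F_def F'_def by (rule fp_map_group_hom[OF H p'])
  have pK: "fp_map H p ` K \<subseteq> K'" unfolding K_def K'_def by (rule fp_map_verbal_kernel[OF H p W])
  have pK': "fp_map H p' ` K' \<subseteq> K" unfolding K_def K'_def by (rule fp_map_verbal_kernel[OF H p' W])
  \<comment> \<open>\<open>P\<close> and \<open>P'\<close> are the maps between the two verbal
    products induced by \<open>p\<close> and \<open>p'\<close>.\<close>
  define P where "P = (\<lambda>C. K' <#>\<^bsub>F'\<^esub> fp_map H p ` C)"
  define P' where "P' = (\<lambda>D. K <#>\<^bsub>F\<^esub> fp_map H p' ` D)"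
  have P: "P (K #>\<^bsub>F\<^esub> w) = K' #>\<^bsub>F'\<^esub> fp_map H p w" if "w \<in> carrier F" for w
    unfolding P_def by (rule P.set_mult_image_rcos[OF K.normal_axioms K'.normal_axioms pK that])
  have P': "P' (K' #>\<^bsub>F'\<^esub> w) = K #>\<^bsub>F\<^esub> fp_map H p' w" if "w \<in> carrier F'" for w
    unfolding P'_def by (rule P'.set_mult_image_rcos[OF K'.normal_axioms K.normal_axioms pK' that])
  \<comment> \<open>All letters of \<open>r C\<close> have their index in \<open>Z\<close>, where
    \<open>p'\<close> undoes \<open>p\<close>.\<close>
  have P_retract: "P' (P C) = C" if C: "C \<in> fst ` A" for C
  proof -
    have "fp_map H p' (fp_map H p (r C)) = fp_map H Some (r C)"
    proof (rule fp_map_eqI[OF H p p'])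
      show "partial_inj X X Some" by (simp add: partial_inj_def)
      show "r C \<in> reduced_words H X" using r(1)[OF C] by (simp add: F_def)
      fix x h assume "(x, h) \<in> set (r C)"
      then have "x \<in> Z" using rZ[OF C] by (auto simp: Z_def)
      then show "Option.bind (p x) p' = Some x" using \<pi>(2) by (simp add: p_def p'_def)
    qed
    then have "fp_map H p' (fp_map H p (r C)) = r C"
      using r(1)[OF C] fp_map_Some_id by (simp add: F_def)
    then show ?thesis using r[OF C] P P' P.hom_closed by metis
  qed
  have P_act: "P (induced_action \<alpha> g C) = induced_action (\<beta> \<circ> fst) (\<rho> g, \<phi> g) (P C)"
    if C: "C \<in> fst ` A" and g: "g \<in> E" for C g
  proof -
    have gc: "g \<in> carrier \<Gamma>" "(\<rho> g, \<phi> g) \<in> carrier (Q \<times>\<times> Q')" using g E \<rho> \<phi>(1) by auto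
    have rc: "r C \<in> reduced_words H X" using r(1)[OF C] by (simp add: F_def)
    \<comment> \<open>The common value of two routes on the letters of \<open>r C\<close>: moving by
      \<open>g\<close> and then applying \<open>p\<close>, or applying \<open>p\<close> and then
      moving by \<rho> \<open>g\<close>. The first route needs \<alpha> \<open>g x\<close> to lie in
      \<open>Z\<close>.\<close>
    define t where "t = (\<lambda>x. if x \<in> Z then Some (\<beta> (\<rho> g) (\<pi> x)) else None)"
    have \<beta>g: "partial_inj Y Y (\<lambda>y. Some ((\<beta> \<circ> fst) (\<rho> g, \<phi> g) y))"
      by (rule partial_inj_action[OF H \<beta>' W gc(2)])
    have t: "partial_inj X Y t"
      unfolding t_def
    proof (rule partial_inj_restrict)
      have "\<beta> (\<rho> g) ` Y = Y" "inj_on (\<beta> (\<rho> g)) Y"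
        using group_action.surj_prop[OF \<beta>] group_action.inj_prop[OF \<beta>] gc(2) by simp_all
      moreover have \<pi>Z: "\<pi> ` Z \<subseteq> Y" using \<pi>(1) by blast
      ultimately show "(\<lambda>x. \<beta> (\<rho> g) (\<pi> x)) ` Z \<subseteq> Y" "inj_on (\<lambda>x. \<beta> (\<rho> g) (\<pi> x)) Z"
        using comp_inj_on[OF \<pi>(2) inj_on_subset[OF _ \<pi>Z], of "\<beta> (\<rho> g)"]
        by (blast, simp add: comp_def)
    qed
    have "fp_map H p (s g (r C)) = fp_map H t (r C)"
      unfolding s_def
    proof (rule fp_map_eqI[OF H partial_inj_action[OF H \<alpha> W gc(1)] p t rc])
      fix x h assume "(x, h) \<in> set (r C)"
      then have "x \<in> Z\<^sub>0" using rZ[OF C] by blast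
      then have "x \<in> Z" "\<alpha> g x \<in> Z" using g by (auto simp: Z_def)
      then show "Option.bind (Some (\<alpha> g x)) p = t x"
        using \<pi>_act g by (simp add: p_def t_def)
    qed
    also have "\<dots> = s' (\<rho> g, \<phi> g) (fp_map H p (r C))"
      unfolding s'_def
      by (rule fp_map_eqI[OF H p \<beta>g t rc, symmetric]) (simp add: p_def t_def)
    finally have eq: "fp_map H p (s g (r C)) = s' (\<rho> g, \<phi> g) (fp_map H p (r C))" .
    have "induced_action \<alpha> g C = K #>\<^bsub>F\<^esub> s g (r C)"
      using induced_action_rcos[OF H \<alpha> W gc(1) rc] r(2)[OF C] by (simp add: F_def K_def s_def)
    moreover have "s g (r C) \<in> carrier F"
      using fp_map_closed[OF H partial_inj_action[OF H \<alpha> W gc(1)] rc] by (simp add: F_def s_def)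
    ultimately have "P (induced_action \<alpha> g C) = K' #>\<^bsub>F'\<^esub> s' (\<rho> g, \<phi> g) (fp_map H p (r C))"
      using P eq by simp
    moreover have "P C = K' #>\<^bsub>F'\<^esub> fp_map H p (r C)" using P r[OF C] by metis
    ultimately show ?thesis
      using induced_action_rcos[OF H \<beta>' W gc(2), of "fp_map H p (r C)"] P.hom_closed[OF r(1)[OF C]]
      by (simp add: F'_def K'_def s'_def)
  qed
  have P_mult: "P (C <#>\<^bsub>F\<^esub> D) = P C <#>\<^bsub>F'\<^esub> P D"
    if "C \<in> carrier (F Mod K)" "D \<in> carrier (F Mod K)" for C D
    using that by (auto simp: carrier_FactGroup K.rcos_sum K'.rcos_sum P)
  define \<Phi> where "\<Phi> = (\<lambda>(C, g). (P C, (\<rho> g, \<phi> g)))"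
  show "\<exists>(T :: ((nat \<times> 'h) list set \<times> nat \<times> nat) monoid) \<Phi>.
      group T \<and> finite (carrier T) \<and> \<Phi> \<in> A \<rightarrow> carrier T \<and> inj_on \<Phi> A \<and>
      (\<forall>a\<in>A. \<forall>b\<in>A. a \<otimes>\<^bsub>verbal_wreath_product ?W H \<Gamma> X \<alpha>\<^esub> b \<in> A \<longrightarrow>
        \<Phi> (a \<otimes>\<^bsub>verbal_wreath_product ?W H \<Gamma> X \<alpha>\<^esub> b) = \<Phi> a \<otimes>\<^bsub>T\<^esub> \<Phi> b)"
  proof (intro exI conjI ballI impI)
    show "group T" unfolding T_def by (rule group_verbal_wreath_product[OF H \<beta>' W])
    show "finite (carrier T)"
      using finite_verbal_product_n_word[OF H assms(5) Y assms(1)] Q Q'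
      by (simp add: T_def verbal_wreath_product_def semidirect_product_def)
    have PC: "P C \<in> carrier (verbal_product ?W H Y)" if "C \<in> fst ` A" for C
    proof -
      have "P C = K' #>\<^bsub>F'\<^esub> fp_map H p (r C)" using P r[OF that] by metis
      then show ?thesis
        using P.hom_closed[OF r(1)[OF that]]
        by (auto simp: verbal_product_eq carrier_FactGroup F'_def K'_def)
    qed
    show "\<Phi> \<in> A \<rightarrow> carrier T"
    proof
      fix a assume "a \<in> A"
      then obtain C g where a: "a = (C, g)" "C \<in> fst ` A" "g \<in> E" by (cases a) (force simp: E_def)
      then have "\<rho> g \<in> carrier Q" "\<phi> g \<in> carrier Q'" using \<rho> \<phi>(1) E(2) by blast+
      then show "\<Phi> a \<in> carrier T"
        using PC[OF a(2)]
        by (simp add: a(1) \<Phi>_def T_def verbal_wreath_product_def semidirect_product_def)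
    qed
    show "inj_on \<Phi> A"
    proof (rule inj_onI, clarify)
      fix C g D h assume *: "(C, g) \<in> A" "(D, h) \<in> A" "\<Phi> (C, g) = \<Phi> (D, h)"
      then have "P C = P D" "\<phi> g = \<phi> h" by (auto simp: \<Phi>_def)
      moreover have "C \<in> fst ` A" "D \<in> fst ` A" "g \<in> E" "h \<in> E" using * by (force simp: E_def)+
      \<comment> \<open>The retraction \<open>P'\<close> recovers the first component, and
        injectivity of \<phi> on \<open>E\<close> the second.\<close>
      ultimately show "C = D \<and> g = h" using P_retract \<phi>(2) by (metis inj_onD)
    qed
    fix a b assume ab: "a \<in> A" "b \<in> A" "a \<otimes>\<^bsub>verbal_wreath_product ?W H \<Gamma> X \<alpha>\<^esub> b \<in> A"
    obtain C g D h where a: "a = (C, g)" and b: "b = (D, h)" by (cases a, cases b)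
    have prod: "a \<otimes>\<^bsub>verbal_wreath_product ?W H \<Gamma> X \<alpha>\<^esub> b = (C <#>\<^bsub>F\<^esub> induced_action \<alpha> g D, g \<otimes>\<^bsub>\<Gamma>\<^esub> h)"
      by (simp add: a b verbal_wreath_product_def semidirect_product_def verbal_product_eq F_def)
    \<comment> \<open>The product lies in \<open>A\<close>, so its second component lies in
      \<open>E\<close>; this is what the local multiplicativity of \<rho> and \<phi>
      requires.\<close>
    have CD: "D \<in> fst ` A" "g \<in> E" "h \<in> E" "g \<otimes>\<^bsub>\<Gamma>\<^esub> h \<in> E"
      using ab prod a b by (force simp: E_def)+
    have "D \<in> carrier (F Mod K)" "C \<in> carrier (F Mod K)"
      using ab a b A' by (auto simp: verbal_product_eq F_def K_def)
    \<comment> \<open>The translate of \<open>D\<close> need not occur as a first component of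
      \<open>A\<close>. Membership in the quotient is enough, because \<open>P\<close> is
      multiplicative on all of it.\<close>
    moreover have "induced_action \<alpha> g D \<in> carrier (F Mod K)"
    proof -
      have g: "g \<in> carrier \<Gamma>" and rD: "r D \<in> reduced_words H X"
        using CD E r(1) by (auto simp: F_def)
      have "induced_action \<alpha> g D = K #>\<^bsub>F\<^esub> s g (r D)"
        using induced_action_rcos[OF H \<alpha> W g rD] r(2)[OF CD(1)] by (simp add: F_def K_def s_def)
      moreover have "s g (r D) \<in> carrier F"
        using fp_map_closed[OF H partial_inj_action[OF H \<alpha> W g] rD] by (simp add: F_def s_def)
      ultimately show ?thesis by (auto simp: carrier_FactGroup)
    qed
    ultimately have "P (C <#>\<^bsub>F\<^esub> induced_action \<alpha> g D) =
        P C <#>\<^bsub>F'\<^esub> induced_action (\<beta> \<circ> fst) (\<rho> g, \<phi> g) (P D)"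
      using P_mult P_act CD by simp
    then show "\<Phi> (a \<otimes>\<^bsub>verbal_wreath_product ?W H \<Gamma> X \<alpha>\<^esub> b) = \<Phi> a \<otimes>\<^bsub>T\<^esub> \<Phi> b"
      unfolding prod using CD \<rho>_mult \<phi>_mult
      by (simp add: \<Phi>_def T_def a b verbal_wreath_product_def semidirect_product_def
          verbal_product_eq F'_def)
  qed
qed

end
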